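(* Suppose hyperbolic $A,B\in\mathrm{GL}(n,\mathbb{Z})$ are similar. If $A$ and $B$ are strongly BF-equivalent, then there exists a topological $R$-module isomorphism $\Psi:G_A\to G_B$.
   Context: A matrix in $\mathrm{GL}(n,\mathbb{Z})$ is hyperbolic if it has no eigenvalue of modulus $1$. Matrices $A,B\in\mathrm{GL}(n,\mathbb{Z})$ are similar if there is $C\in\mathrm{GL}(n,\mathbb{Q})$ with $AC=CB$. For similar $A,B$, a polynomial $q\in\mathbb{Z}[x]$ satisfies $q(A)=0$ if and only if $q(B)=0$; let $R=\mathbb{Z}[x]/\{q\in\mathbb{Z}[x]: q(A)=0\}$, so that $R\cong\mathbb{Z}[A]\cong\mathbb{Z}[B]$ as rings via $x\mapsto A$ and $x\mapsto B$ (when the common characteristic polynomial $p(x)$ is irreducible, $R=\mathbb{Z}[x]/(p(x))$). Regard $\mathbb{Z}^n$ as row vectors, with $A$ acting on the right by $m\mapsto mA$. For $k\in\mathbb{N}=\{1,2,\dots\}$ set $N_{k,A}=\mathbb{Z}^n(A^{k!}-I)$ and $G_{k,A}=\mathbb{Z}^n/N_{k,A}$, a finite group with elements $[m]_{k,A}=m+N_{k,A}$, given the discrete topology and the $R$-module structure in which $x$ acts by $[m]_{k,A}\mapsto[mA]_{k,A}$. For $l\le k$ one has $N_{k,A}\le N_{l,A}$, and there is the canonical epimorphism $\varphi_{k,l,A}:G_{k,A}\to G_{l,A}$, $[m]_{k,A}\mapsto[m]_{l,A}$. The profinite $R$-module $G_A$ is the inverse limit $\varprojlim_{k\in\mathbb{N}}G_{k,A}\le\prod_{k\in\mathbb{N}}G_{k,A}$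 of this inverse system, with the topology induced by the product topology, and with $x$ acting by $\Gamma_A(\{[m_k]_{k,A}\}_{k})=\{[m_kA]_{k,A}\}_{k}$. The module $G_B$ is defined in the same way from $B$, with $x$ acting through $B$. A topological $R$-module isomorphism is an $R$-module isomorphism that is also a homeomorphism. For $g\in\mathbb{Z}[x]$ with $g(A)$ invertible (i.e. $\det g(A)\ne0$; equivalently $\det g(B)\ne 0$), set $\mathrm{BF}_g(A)=\mathbb{Z}^n/\mathbb{Z}^ng(A)$ and $\mathrm{BF}_g(B)=\mathbb{Z}^n/\mathbb{Z}^ng(B)$, which are $R$-modules with $x$ acting by right multiplication by $A$, respectively $B$. The similar hyperbolic matrices $A$ and $B$ are strongly BF-equivalent if $\mathrm{BF}_g(A)$ and $\mathrm{BF}_g(B)$ are isomorphic as $R$-modules for every $g\in\mathbb{Z}[x]$ with $g(A)$ invertible. *)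

theory Defs
  imports
    "HOL-Algebra.QuotRing"
    "HOL-Analysis.Function_Topology"
    "Jordan_Normal_Form.VS_Connect"
    "Jordan_Normal_Form.Char_Poly"
begin

definition GL :: "nat \<Rightarrow> 'a::comm_ring_1 mat set" where
  "GL n = {A \<in> carrier_mat n n. invertible_mat A}"

definition hyperbolic :: "int mat \<Rightarrow> bool" where
  "hyperbolic A \<longleftrightarrow> (\<forall>z::complex. eigenvalue (map_mat of_int A) z \<longrightarrow> cmod z \<noteq> 1)"

definition similar_over_rat :: "nat \<Rightarrow> int mat \<Rightarrow> int mat \<Rightarrow> bool" where
  "similar_over_rat n A B \<longleftrightarrow>
     (\<exists>C \<in> (GL n :: rat mat set). map_mat of_int A * C = C * map_mat of_int B)"

definition poly_mat :: "nat \<Rightarrow> int poly \<Rightarrow> int mat \<Rightarrow> int mat" where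
  "poly_mat n q A =
     (\<Oplus>\<^bsub>ring_mat TYPE(int) n ()\<^esub> i \<in> {..degree q}. coeff q i \<cdot>\<^sub>m (A ^\<^sub>m i))"

text \<open>The ring \<open>R = \<int>[x] / {q. q(A) = 0}\<close>; its elements are cosets of integer polynomials.
  For similar matrices \<open>A\<close> and \<open>B\<close> the two annihilators, hence the two rings, are equal.\<close>

definition annihilator :: "nat \<Rightarrow> int mat \<Rightarrow> int poly set" where
  "annihilator n A = {q. poly_mat n q A = 0\<^sub>m n n}"

definition poly_ring_mod :: "nat \<Rightarrow> int mat \<Rightarrow> int poly set ring" where
  "poly_ring_mod n A = (class_ring :: int poly ring) Quot (annihilator n A)"

text \<open>Row vectors are the \<open>1 \<times> n\<close> matrices, so that \<open>m * A\<close> is the right action of \<open>A\<close>.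
  A coset \<open>r\<close> acts through any polynomial \<open>q\<close> it contains, by \<open>m \<mapsto> m q(A)\<close>; two such \<open>q\<close> differ by
  an element of the annihilator of \<open>A\<close>, so the choice made by \<open>SOME\<close> does not matter. The fields
  \<open>mult\<close> and \<open>one\<close> of the record type play no role for modules.\<close>

definition row_module :: "nat \<Rightarrow> int mat \<Rightarrow> (int poly set, int mat) module" where
  "row_module n A =
     \<lparr>carrier = carrier_mat 1 n, monoid.mult = undefined, one = undefined, zero = 0\<^sub>m 1 n, add = (+),
      module.smult = (\<lambda>r m. m * poly_mat n (SOME q. q \<in> r) A)\<rparr>"

definition quotient_module :: "('r, 'm) module \<Rightarrow> 'm set \<Rightarrow> ('r, 'm set) module" where
  "quotient_module M N =
     \<lparr>carrier = a_rcosets\<^bsub>M\<^esub> N, monoid.mult = undefined, one = undefined, zero = N, add = set_add M,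
      module.smult = (\<lambda>r X. \<Union>m\<in>X. N +>\<^bsub>M\<^esub> (r \<odot>\<^bsub>M\<^esub> m))\<rparr>"

definition module_iso ::
  "('r, 'a) ring_scheme \<Rightarrow> ('r, 'm, 'b) module_scheme \<Rightarrow> ('r, 'p, 'c) module_scheme \<Rightarrow> ('m \<Rightarrow> 'p) set"
  where
  "module_iso R M N =
     {h \<in> LinearCombinations.module_hom R M N. bij_betw h (carrier M) (carrier N)}"

definition row_image :: "nat \<Rightarrow> int mat \<Rightarrow> int mat set" where
  "row_image n M = {m * M | m. m \<in> carrier_mat 1 n}"

definition BF :: "nat \<Rightarrow> int poly \<Rightarrow> int mat \<Rightarrow> (int poly set, int mat set) module" where
  "BF n g A = quotient_module (row_module n A) (row_image n (poly_mat n g A))"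

text \<open>Invertibility of \<open>g(A)\<close> is meant over the rationals, that is, \<open>det (g(A)) \<noteq> 0\<close>.\<close>

definition strongly_BF_equivalent :: "nat \<Rightarrow> int mat \<Rightarrow> int mat \<Rightarrow> bool" where
  "strongly_BF_equivalent n A B \<longleftrightarrow>
     (\<forall>g. det (poly_mat n g A) \<noteq> 0 \<longrightarrow> module_iso (poly_ring_mod n A) (BF n g A) (BF n g B) \<noteq> {})"

definition N_level :: "nat \<Rightarrow> int mat \<Rightarrow> nat \<Rightarrow> int mat set" where
  "N_level n A k = row_image n (A ^\<^sub>m fact k - 1\<^sub>m n)"

definition G_level :: "nat \<Rightarrow> int mat \<Rightarrow> nat \<Rightarrow> (int poly set, int mat set) module" where
  "G_level n A k = quotient_module (row_module n A) (N_level n A k)"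

text \<open>The canonical epimorphism \<open>m + N\<^sub>k \<mapsto> m + N\<^sub>l\<close> for \<open>l \<le> k\<close>.\<close>

definition G_proj :: "nat \<Rightarrow> int mat \<Rightarrow> nat \<Rightarrow> nat \<Rightarrow> int mat set \<Rightarrow> int mat set" where
  "G_proj n A k l X = (\<Union>m\<in>X. N_level n A l +>\<^bsub>row_module n A\<^esub> m)"

text \<open>The inverse limit over the index set \<open>{1, 2, \<dots>}\<close>, with coordinatewise operations. Families
  are extensional functions (arbitrary but fixed at the index 0).\<close>

definition G_lim :: "nat \<Rightarrow> int mat \<Rightarrow> (int poly set, nat \<Rightarrow> int mat set) module" where
  "G_lim n A =
     \<lparr>carrier = {f \<in> \<Pi>\<^sub>E k\<in>{1..}. carrier (G_level n A k).
                   \<forall>l\<ge>1. \<forall>k\<ge>l. G_proj n A k l (f k) = f l},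
      monoid.mult = undefined, one = undefined,
      zero = (\<lambda>k\<in>{1..}. \<zero>\<^bsub>G_level n A k\<^esub>),
      add = (\<lambda>f g. \<lambda>k\<in>{1..}. f k \<oplus>\<^bsub>G_level n A k\<^esub> g k),
      module.smult = (\<lambda>r f. \<lambda>k\<in>{1..}. r \<odot>\<^bsub>G_level n A k\<^esub> f k)\<rparr>"

definition G_topology :: "nat \<Rightarrow> int mat \<Rightarrow> (nat \<Rightarrow> int mat set) topology" where
  "G_topology n A =
     subtopology (product_topology (\<lambda>k. discrete_topology (carrier (G_level n A k))) {1..})
       (carrier (G_lim n A))"

end

theory Submission
  imports Defs "HOL-Library.Diagonal_Subsequence"
begin

text \<open>Write \<open>g\<^sub>k = x\<^bsup>k!\<^esup> - 1\<close>. Since \<open>A\<close> has no eigenvalue of modulus one,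
  \<open>g\<^sub>k(A) = A\<^bsup>k!\<^esup> - I\<close> is nonsingular, and by definition \<open>G\<^sub>k\<^sub>,\<^sub>A\<close> is the module
  \<open>BF\<close> for the polynomial \<open>g\<^sub>k\<close>. So strong BF-equivalence supplies, for each \<open>k\<close> separately, some
  \<open>R\<close>-isomorphism between the \<open>k\<close>-th levels of \<open>A\<close> and \<open>B\<close>. Nothing makes these isomorphisms
  compatible with the projections, and the work consists in replacing them by compatible ones.

  Two observations make this possible. First, an isomorphism of \<open>k\<close>-th levels induces an isomorphism
  of \<open>l\<close>-th levels for every \<open>l \<le> k\<close>: because \<open>g\<^sub>l\<close> divides \<open>g\<^sub>k\<close>, the kernel of the
  projection from level \<open>k\<close> to level \<open>l\<close> is \<open>g\<^sub>l\<close> times the module at level \<open>k\<close>, and an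
  \<open>R\<close>-isomorphism respects such a submodule (\<open>level_isomorphism_descend\<close>). Secondly, each level is
  finite because \<open>det g\<^sub>k(A)\<close> is nonzero, so there are only finitely many isomorphisms at each
  level (\<open>finite_level_isomorphism_classes\<close>). The isomorphisms therefore form an inverse system of
  finite nonempty sets, and Koenig's lemma provides a compatible family
  (\<open>koenig_coherent_choice\<close>).

  A compatible family acts coordinatewise on the inverse limits. It is bijective there because it is
  bijective on each level, and it is a homeomorphism because it and its inverse are
  coordinatewise maps between products of discrete spaces
  (\<open>coherent_level_isomorphisms_induce_limit_isomorphism\<close>).

  Similarity of \<open>A\<close> and \<open>B\<close> enters only through the equality of their annihilators: a coset in \<open>R\<close>
  then acts on both sides through the same polynomial.

  An isomorphism of levels is represented by a lift, an arbitrary map \<open>\<psi>\<close> from integer row vectors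
  to integer row vectors that induces it on cosets. The lift need not be linear. The advantage is
  that one and the same \<open>\<psi>\<close> represents the isomorphism at level \<open>k\<close> and all those that it
  induces at lower levels.\<close>

section \<open>Polynomials evaluated at matrices\<close>

text \<open>Horner's scheme: its recursion under \<open>pCons\<close> makes every property of evaluation an
  induction on the polynomial, over the integers, the rationals and the complex numbers alike.\<close>

definition mat_eval :: "nat \<Rightarrow> 'a::comm_ring_1 poly \<Rightarrow> 'a mat \<Rightarrow> 'a mat" where
  "mat_eval n p A = fold_coeffs (\<lambda>c M. c \<cdot>\<^sub>m 1\<^sub>m n + M * A) p (0\<^sub>m n n)"

lemma mat_eval_0 [simp]: "mat_eval n 0 A = 0\<^sub>m n n"
  by (simp add: mat_eval_def)

lemma mat_eval_pCons [simp]: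
  assumes "A \<in> carrier_mat n n"
  shows "mat_eval n (pCons c p) A = c \<cdot>\<^sub>m 1\<^sub>m n + mat_eval n p A * A"
proof (cases "c = 0 \<and> p = 0")
  case True
  have "0 \<cdot>\<^sub>m 1\<^sub>m n = (0\<^sub>m n n :: 'a mat)" by (intro eq_matI) auto
  with True assms show ?thesis by simp
qed (auto simp: mat_eval_def)

lemma mat_eval_carrier [simp, intro]:
  assumes A: "A \<in> carrier_mat n n"
  shows "mat_eval n p A \<in> carrier_mat n n"
  by (induct p) (use A in auto)

lemma mat_eval_dim [simp]:
  assumes "A \<in> carrier_mat n n"
  shows "dim_row (mat_eval n p A) = n" "dim_col (mat_eval n p A) = n"
  using mat_eval_carrier[OF assms, of p] by auto

lemma mat_eval_add:
  assumes A: "A \<in> carrier_mat n n"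
  shows "mat_eval n (p + q) A = mat_eval n p A + mat_eval n q A"
proof (induct p q rule: poly_induct2)
  case 0
  show ?case by simp
next
  case (pCons a p b q)
  have "mat_eval n (pCons a p + pCons b q) A
      = (a + b) \<cdot>\<^sub>m 1\<^sub>m n + (mat_eval n p A * A + mat_eval n q A * A)"
    using A pCons by (simp add: add_mult_distrib_mat[OF mat_eval_carrier[OF A] mat_eval_carrier[OF A] A])
  also have "\<dots> = mat_eval n (pCons a p) A + mat_eval n (pCons b q) A"
    using A by (intro eq_matI) (auto simp: algebra_simps)
  finally show ?case .
qed

lemma mat_eval_smult:
  assumes A: "A \<in> carrier_mat n n"
  shows "mat_eval n (Polynomial.smult c p) A = c \<cdot>\<^sub>m mat_eval n p A"
proof (induct p)
  case 0
  show ?case by (intro eq_matI) auto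
next
  case (pCons a p)
  have "mat_eval n (Polynomial.smult c (pCons a p)) A
      = (c * a) \<cdot>\<^sub>m 1\<^sub>m n + c \<cdot>\<^sub>m (mat_eval n p A * A)"
    using A pCons mult_smult_assoc_mat[OF mat_eval_carrier[OF A] A] by simp
  also have "\<dots> = c \<cdot>\<^sub>m mat_eval n (pCons a p) A"
    using A by (intro eq_matI) (auto simp: algebra_simps)
  finally show ?case .
qed

text \<open>The factors are reversed because the recursion multiplies by \<open>A\<close> on the right.\<close>

lemma mat_eval_mult:
  assumes A: "A \<in> carrier_mat n n"
  shows "mat_eval n (p * q) A = mat_eval n q A * mat_eval n p A"
proof (induct p)
  case 0
  show ?case using A by simp
next
  case (pCons a p)
  let ?P = "mat_eval n p A" and ?Q = "mat_eval n q A"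
  have P: "?P \<in> carrier_mat n n" and Q: "?Q \<in> carrier_mat n n" using A by auto
  have z: "0 \<cdot>\<^sub>m 1\<^sub>m n + M = M" if "M \<in> carrier_mat n n" for M :: "'a mat"
    using that by (intro eq_matI) auto
  have "mat_eval n (pCons a p * q) A = a \<cdot>\<^sub>m ?Q + (0 \<cdot>\<^sub>m 1\<^sub>m n + ?Q * ?P * A)"
    using A pCons by (simp add: mat_eval_add mat_eval_smult)
  also have "\<dots> = a \<cdot>\<^sub>m ?Q + ?Q * ?P * A"
    using A by (subst z) auto
  also have "\<dots> = ?Q * (a \<cdot>\<^sub>m 1\<^sub>m n) + ?Q * (?P * A)"
    using assoc_mult_mat[OF Q P A] mult_smult_distrib[OF Q one_carrier_mat] Q by simp
  also have "\<dots> = ?Q * (a \<cdot>\<^sub>m 1\<^sub>m n + ?P * A)"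
    using A by (intro mult_add_distrib_mat[symmetric, of _ n n _ n]) auto
  finally show ?case using A by simp
qed

lemma mat_eval_monom:
  assumes A: "A \<in> carrier_mat n n"
  shows "mat_eval n (monom 1 k) A = A ^\<^sub>m k"
proof (induct k)
  case 0
  show ?case using A by (simp add: monom_0) (intro eq_matI, auto)
next
  case (Suc k)
  have "0 \<cdot>\<^sub>m 1\<^sub>m n + A ^\<^sub>m k * A = A ^\<^sub>m k * A"
    using A by (intro eq_matI) (auto simp: pow_mat_dim_square)
  then show ?case using A Suc by (simp add: monom_Suc)
qed

lemma mat_eval_one: assumes "A \<in> carrier_mat n n" shows "mat_eval n 1 A = 1\<^sub>m n"
  using mat_eval_monom[OF assms, of 0] assms by simp

lemma mat_eval_commute:
  assumes "A \<in> carrier_mat n n"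
  shows "mat_eval n p A * mat_eval n q A = mat_eval n q A * mat_eval n p A"
  by (metis assms mat_eval_mult mult.commute)

lemma mat_eval_pow_minus_one:
  assumes A: "A \<in> carrier_mat n n"
  shows "mat_eval n (monom 1 k - 1) A = A ^\<^sub>m k - 1\<^sub>m n"
proof -
  have "mat_eval n (monom 1 k + Polynomial.smult (- 1) 1) A = A ^\<^sub>m k + (- 1) \<cdot>\<^sub>m 1\<^sub>m n"
    by (simp only: mat_eval_add[OF A] mat_eval_smult[OF A] mat_eval_monom[OF A] mat_eval_one[OF A])
  also have "\<dots> = A ^\<^sub>m k - 1\<^sub>m n"
    using A by (intro eq_matI) (auto simp: pow_mat_dim_square)
  finally show ?thesis by (simp only: smult_minus_left smult_1_left flip: diff_conv_add_uminus)
qed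

lemma poly_mat_eq_mat_eval:
  assumes A: "A \<in> carrier_mat n n"
  shows "poly_mat n q A = mat_eval n q A"
proof -
  interpret R: ring "ring_mat TYPE(int) n ()" by (rule ring_mat)
  let ?S = "\<lambda>N q. \<Oplus>\<^bsub>ring_mat TYPE(int) n ()\<^esub> i \<in> {..N}. coeff q i \<cdot>\<^sub>m (A ^\<^sub>m i)"
  have c: "coeff q i \<cdot>\<^sub>m (A ^\<^sub>m i) \<in> carrier (ring_mat TYPE(int) n ())" for q i
    using A by (simp add: ring_mat_simps)
  \<comment> \<open>Any bound \<open>N\<close> on the degree will do; this avoids tracking how \<open>pCons\<close> changes the degree of zero.\<close>
  have "?S N q = mat_eval n q A" if "degree q \<le> N" for N
    using that
  proof (induct q arbitrary: N)
    case 0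
    have "coeff 0 i \<cdot>\<^sub>m (A ^\<^sub>m i) = \<zero>\<^bsub>ring_mat TYPE(int) n ()\<^esub>" for i
      using A by (intro eq_matI) (auto simp: ring_mat_simps pow_mat_dim_square)
    then show ?case by (simp add: ring_mat_simps)
  next
    case (pCons a q)
    show ?case
    proof (cases N)
      case 0
      with pCons have "q = 0" by (auto split: if_splits)
      with 0 A c[of "pCons a q" 0] show ?thesis
        by (simp add: ring_mat_simps)
    next
      case (Suc M)
      have deg: "degree q \<le> M" using pCons(3) Suc by (auto split: if_splits)
      have "?S N (pCons a q) =
          (\<Oplus>\<^bsub>ring_mat TYPE(int) n ()\<^esub> i \<in> {..M}. coeff (pCons a q) (Suc i) \<cdot>\<^sub>m (A ^\<^sub>m Suc i))
          \<oplus>\<^bsub>ring_mat TYPE(int) n ()\<^esub> (coeff (pCons a q) 0 \<cdot>\<^sub>m (A ^\<^sub>m 0))"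
        unfolding Suc using c by (intro R.finsum_Suc2) auto
      also have "(\<lambda>i. coeff (pCons a q) (Suc i) \<cdot>\<^sub>m (A ^\<^sub>m Suc i))
          = (\<lambda>i. (coeff q i \<cdot>\<^sub>m (A ^\<^sub>m i)) \<otimes>\<^bsub>ring_mat TYPE(int) n ()\<^esub> A)"
        using A mult_smult_assoc_mat[OF pow_carrier_mat[OF A] A]
        by (intro ext) (simp add: ring_mat_simps)
      also have "(\<Oplus>\<^bsub>ring_mat TYPE(int) n ()\<^esub> i \<in> {..M}. (coeff q i \<cdot>\<^sub>m (A ^\<^sub>m i)) \<otimes>\<^bsub>ring_mat TYPE(int) n ()\<^esub> A)
          = ?S M q \<otimes>\<^bsub>ring_mat TYPE(int) n ()\<^esub> A"
        using A c by (intro R.finsum_ldistr[symmetric]) (auto simp: ring_mat_simps)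
      also have "?S M q = mat_eval n q A" by (rule pCons(2)[OF deg])
      finally show ?thesis
        using A by (simp add: ring_mat_simps) (intro comm_add_mat[of _ n n], auto)
    qed
  qed
  then show ?thesis by (simp add: poly_mat_def)
qed

lemma mat_eval_map_mat:
  fixes h :: "'a::comm_ring_1 \<Rightarrow> 'b::comm_ring_1"
  assumes h: "comm_ring_hom h" and A: "A \<in> carrier_mat n n"
  shows "mat_eval n (map_poly h p) (map_mat h A) = map_mat h (mat_eval n p A)"
proof -
  interpret comm_ring_hom h by (rule h)
  show ?thesis
  proof (induct p)
    case 0
    show ?case by (intro eq_matI) auto
  next
    case (pCons a p)
    have "mat_eval n (map_poly h (pCons a p)) (map_mat h A)
        = h a \<cdot>\<^sub>m 1\<^sub>m n + map_mat h (mat_eval n p A) * map_mat h A"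
      using A pCons by (simp add: map_poly_pCons)
    also have "\<dots> = h a \<cdot>\<^sub>m 1\<^sub>m n + map_mat h (mat_eval n p A * A)"
      using A by (subst mat_hom_mult[of _ n n _ n]) auto
    also have "\<dots> = map_mat h (mat_eval n (pCons a p) A)"
      using A by (intro eq_matI) (auto simp: hom_add hom_mult)
    finally show ?case .
  qed
qed

text \<open>A matrix that conjugates \<open>A\<close> into \<open>B\<close> conjugates \<open>p(A)\<close> into \<open>p(B)\<close>; stated
  without inverses so that the induction stays multiplicative.\<close>

lemma mat_eval_intertwine:
  assumes A: "A \<in> carrier_mat n n" and B: "B \<in> carrier_mat n n" and C: "C \<in> carrier_mat n n"
    and AC: "A * C = C * B"
  shows "mat_eval n p A * C = C * mat_eval n p B"
proof (induct p)
  case 0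
  show ?case using C by simp
next
  case (pCons a p)
  let ?P = "mat_eval n p A" and ?Q = "mat_eval n p B"
  have P: "?P \<in> carrier_mat n n" and Q: "?Q \<in> carrier_mat n n" using A B by auto
  have "(a \<cdot>\<^sub>m 1\<^sub>m n + ?P * A) * C = (a \<cdot>\<^sub>m 1\<^sub>m n) * C + ?P * A * C"
    using A C by (intro add_mult_distrib_mat[of _ n n _ _ n]) auto
  also have "?P * A * C = ?P * C * B"
    using assoc_mult_mat[OF P A C] assoc_mult_mat[OF P C B] AC by simp
  also have "\<dots> = C * (?Q * B)"
    using pCons(2) assoc_mult_mat[OF C Q B] by simp
  also have "(a \<cdot>\<^sub>m 1\<^sub>m n) * C = C * (a \<cdot>\<^sub>m 1\<^sub>m n)"
    using C mult_smult_distrib[OF C one_carrier_mat] mult_smult_assoc_mat[OF one_carrier_mat C]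
    by simp
  also have "C * (a \<cdot>\<^sub>m 1\<^sub>m n) + C * (?Q * B) = C * (a \<cdot>\<^sub>m 1\<^sub>m n + ?Q * B)"
    using B C by (intro mult_add_distrib_mat[symmetric, of _ n n _ n]) auto
  finally show ?case using A B by simp
qed

section \<open>The annihilator and the coefficient ring\<close>

text \<open>Over the rationals \<open>q(A)\<close> and \<open>q(B)\<close> are conjugate, so one vanishes exactly when
  the other does, and an integer matrix vanishes exactly when its rational image does.\<close>

lemma annihilator_similar:
  assumes A: "A \<in> carrier_mat n n" and B: "B \<in> carrier_mat n n" and sim: "similar_over_rat n A B"
  shows "annihilator n A = annihilator n B"
proof -
  let ?h = "of_int :: int \<Rightarrow> rat"
  obtain C where "C \<in> (GL n :: rat mat set)" and AC: "map_mat ?h A * C = C * map_mat ?h B"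
    using sim by (auto simp: similar_over_rat_def)
  then obtain D where C: "C \<in> carrier_mat n n" and CD: "C * D = 1\<^sub>m n" and DC: "D * C = 1\<^sub>m (dim_row D)"
    by (auto simp: GL_def invertible_mat_def inverts_mat_def)
  have D: "D \<in> carrier_mat n n"
    using arg_cong[OF CD, of dim_col] arg_cong[OF DC, of dim_col] C by auto
  have h: "comm_ring_hom ?h" by (rule of_int_hom.comm_ring_hom_axioms)
  have eq: "map_mat ?h (mat_eval n q A) * C = C * map_mat ?h (mat_eval n q B)" for q
    unfolding mat_eval_map_mat[OF h A, symmetric] mat_eval_map_mat[OF h B, symmetric]
    using A B C AC by (intro mat_eval_intertwine) auto
  have "mat_eval n q A = 0\<^sub>m n n \<longleftrightarrow> mat_eval n q B = 0\<^sub>m n n" for q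
  proof -
    let ?P = "map_mat ?h (mat_eval n q A)" and ?Q = "map_mat ?h (mat_eval n q B)"
    have P: "?P \<in> carrier_mat n n" and Q: "?Q \<in> carrier_mat n n" using A B by auto
    have inj: "map_mat ?h M = 0\<^sub>m n n \<longleftrightarrow> M = 0\<^sub>m n n" for M by (auto simp: mat_eq_iff)
    have "?P = ?P * C * D" using P C D CD assoc_mult_mat[OF P C D] by simp
    moreover have "?Q = D * (C * ?Q)" using Q C D DC assoc_mult_mat[OF D C Q] by simp
    ultimately have "?P = 0\<^sub>m n n \<longleftrightarrow> ?Q = 0\<^sub>m n n"
      using eq[of q] C D by (metis left_mult_zero_mat right_mult_zero_mat)
    then show ?thesis by (simp only: inj)
  qed
  then show ?thesis by (simp add: annihilator_def poly_mat_eq_mat_eval[OF A] poly_mat_eq_mat_eval[OF B])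
qed

text \<open>The scalar action of \<open>R\<close> is defined through a choice of polynomial in a coset. Any two
  choices differ by a polynomial that kills \<open>A\<close>, so the coset of \<open>q\<close> acts as \<open>q(A)\<close>.\<close>

lemma mat_eval_some_in_annihilator_coset:
  assumes A: "A \<in> carrier_mat n n"
  shows "mat_eval n (SOME p. p \<in> annihilator n A +>\<^bsub>class_ring\<^esub> q) A = mat_eval n q A"
proof -
  have coset: "annihilator n A +>\<^bsub>class_ring\<^esub> q = {a + q | a. a \<in> annihilator n A}"
    unfolding a_r_coset_def' ring.simps by blast
  have "0 \<in> annihilator n A" by (simp add: annihilator_def poly_mat_eq_mat_eval[OF A])
  then have "0 + q \<in> annihilator n A +>\<^bsub>class_ring\<^esub> q" unfolding coset by blast
  then have "(SOME p. p \<in> annihilator n A +>\<^bsub>class_ring\<^esub> q) \<in> annihilator n A +>\<^bsub>class_ring\<^esub> q"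
    by (rule someI)
  then obtain a where "a \<in> annihilator n A" "(SOME p. p \<in> annihilator n A +>\<^bsub>class_ring\<^esub> q) = a + q"
    unfolding coset by blast
  with A show ?thesis
    by (simp add: annihilator_def poly_mat_eq_mat_eval[OF A] mat_eval_add[OF A] left_add_zero_mat[OF mat_eval_carrier])
qed

section \<open>Hyperbolicity\<close>

text \<open>Split off a root \<open>z\<close> and write \<open>p = q (x - z)\<close>. Either \<open>w = q(A) v\<close> is nonzero,
  and then \<open>(A - z) w = 0\<close> makes it an eigenvector, or \<open>q(A)\<close> already kills \<open>v\<close> and
  the degree has dropped.\<close>

lemma eigenvalue_root_of_annihilating_poly:
  fixes A :: "complex mat"
  assumes A: "A \<in> carrier_mat n n" and v: "v \<in> carrier_vec n" "v \<noteq> 0\<^sub>v n"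
    and "p \<noteq> 0" and "mat_eval n p A *\<^sub>v v = 0\<^sub>v n"
  shows "\<exists>z. poly p z = 0 \<and> eigenvalue A z"
  using assms(4-)
proof (induct "degree p" arbitrary: p rule: less_induct)
  case less
  have "degree p \<noteq> 0"
  proof
    assume "degree p = 0"
    then obtain c where p: "p = [:c:]" by (rule degree_eq_zeroE)
    with less have "c \<noteq> 0" by simp
    have "c \<cdot>\<^sub>m 1\<^sub>m n + 0\<^sub>m n n * A = c \<cdot>\<^sub>m 1\<^sub>m n" using A by simp
    moreover have "(c \<cdot>\<^sub>m 1\<^sub>m n) *\<^sub>v v = c \<cdot>\<^sub>v v"
      using v by (intro eq_vecI) auto
    ultimately have "c \<cdot>\<^sub>v v = 0\<^sub>v n" using less(3) p A by simp
    with v \<open>c \<noteq> 0\<close> show False by (auto simp: vec_eq_iff)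
  qed
  then obtain z where z: "poly p z = 0"
    using fundamental_theorem_of_algebra[of p] by (auto simp: constant_degree)
  then obtain q where p: "p = q * [:- z, 1:]" by (metis dvd_def mult.commute poly_eq_0_iff_dvd)
  with less(2) have q: "q \<noteq> 0" by auto
  have "degree q < degree p" using q unfolding p by (subst degree_mult_eq) auto
  show ?case
  proof (cases "mat_eval n q A *\<^sub>v v = 0\<^sub>v n")
    case True
    with less(1)[OF \<open>degree q < degree p\<close> q] show ?thesis by (auto simp: p)
  next
    case False
    let ?w = "mat_eval n q A *\<^sub>v v"
    have w: "?w \<in> carrier_vec n" using A v by (intro mult_mat_vec_carrier) auto
    have "mat_eval n [:- z, 1:] A = (- z) \<cdot>\<^sub>m 1\<^sub>m n + A"
      using A by (simp, intro eq_matI, auto)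
    then have "mat_eval n p A = ((- z) \<cdot>\<^sub>m 1\<^sub>m n + A) * mat_eval n q A"
      unfolding p mat_eval_mult[OF A] by (simp only:)
    then have "0\<^sub>v n = ((- z) \<cdot>\<^sub>m 1\<^sub>m n + A) *\<^sub>v ?w"
      using less(3) A v by (simp add: assoc_mult_mat_vec[of _ n n _ n])
    also have "\<dots> = (- z) \<cdot>\<^sub>v ?w + A *\<^sub>v ?w"
      using A w by (subst add_mult_distrib_mat_vec[of _ n n]) auto
    finally have "A *\<^sub>v ?w = z \<cdot>\<^sub>v ?w"
      using A w by (auto simp: vec_eq_iff)
    then have "eigenvector A ?w z" using A w False by (simp add: eigenvector_def)
    with z show ?thesis by (auto simp: eigenvalue_def)
  qed
qed

text \<open>A singular \<open>A\<^bsup>k\<^esup> - I\<close> would have a nonzero complex vector in its kernel, and hence \<open>A\<close> would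
  have an eigenvalue among the roots of \<open>x\<^bsup>k\<^esup> - 1\<close>, all of which have modulus one.\<close>

lemma det_pow_minus_one_nonzero:
  assumes A: "A \<in> carrier_mat n n" and hyp: "hyperbolic A" and k: "k > 0"
  shows "det (A ^\<^sub>m k - 1\<^sub>m n) \<noteq> 0"
proof
  assume "det (A ^\<^sub>m k - 1\<^sub>m n) = 0"
  let ?h = "of_int :: int \<Rightarrow> complex"
  let ?p = "monom 1 k - 1 :: int poly"
  have h: "comm_ring_hom ?h" by (rule of_int_hom.comm_ring_hom_axioms)
  have "det (map_mat ?h (mat_eval n ?p A)) = 0"
    using \<open>det _ = 0\<close> by (simp add: mat_eval_pow_minus_one[OF A])
  then obtain v where v: "v \<in> carrier_vec n" "v \<noteq> 0\<^sub>v n"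
    and "mat_eval n (map_poly ?h ?p) (map_mat ?h A) *\<^sub>v v = 0\<^sub>v n"
    using det_0_iff_vec_prod_zero_field[of "map_mat ?h (mat_eval n ?p A)" n] A
    by (auto simp: mat_eval_map_mat[OF h A])
  moreover have p: "map_poly ?h ?p = monom 1 k - 1"
    by (simp add: of_int_poly_hom.hom_minus)
  moreover have "monom 1 k - 1 \<noteq> (0 :: complex poly)"
  proof
    assume "monom 1 k - 1 = (0 :: complex poly)"
    from arg_cong[OF this, of "\<lambda>p. poly p 0"] k show False by (simp add: poly_monom power_0_left)
  qed
  ultimately obtain z where z: "poly (monom 1 k - 1) z = 0" "eigenvalue (map_mat ?h A) z"
    using eigenvalue_root_of_annihilating_poly[of "map_mat ?h A" n v "monom 1 k - 1"] A by auto
  then have "z ^ k = 1" by (simp add: poly_monom)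
  then have "cmod z ^ k = 1" by (metis norm_one norm_power)
  then have "cmod z = 1" using k power_eq_imp_eq_base[of "cmod z" k 1] by simp
  with z hyp show False by (auto simp: hyperbolic_def)
qed

section \<open>Quotients of the row lattice\<close>

text \<open>The coset \<open>x + \<int>\<^sup>n M\<close>, without reference to a module structure on the row vectors. All
  computations in quotients are carried out as equations between such cosets of representatives.\<close>

definition row_coset :: "nat \<Rightarrow> int mat \<Rightarrow> int mat \<Rightarrow> int mat set" where
  "row_coset n M x = {w * M + x | w. w \<in> carrier_mat 1 n}"

lemma row_coset_self:
  assumes "M \<in> carrier_mat n n" "x \<in> carrier_mat 1 n"
  shows "x \<in> row_coset n M x"
proof -
  have "x = 0\<^sub>m 1 n * M + x" using assms by simp
  then show ?thesis unfolding row_coset_def mem_Collect_eq by (intro exI conjI) auto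
qed

lemma row_coset_eq_iff:
  assumes M: "M \<in> carrier_mat n n" and x: "x \<in> carrier_mat 1 n" and y: "y \<in> carrier_mat 1 n"
  shows "row_coset n M x = row_coset n M y \<longleftrightarrow> (\<exists>w\<in>carrier_mat 1 n. x = w * M + y)"
proof
  assume "row_coset n M x = row_coset n M y"
  with row_coset_self[OF M x] show "\<exists>w\<in>carrier_mat 1 n. x = w * M + y"
    by (auto simp: row_coset_def)
next
  assume "\<exists>w\<in>carrier_mat 1 n. x = w * M + y"
  then obtain w where w: "w \<in> carrier_mat 1 n" and xw: "x = w * M + y" by blast
  have 1: "u * M + x = (u + w) * M + y" if "u \<in> carrier_mat 1 n" for u
    using that w M y unfolding xw
    by (subst add_mult_distrib_mat[of _ 1 n _ _ n]) (auto intro!: assoc_add_mat[symmetric, of _ 1 n])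
  have 2: "u * M + y = (u - w) * M + x" if u: "u \<in> carrier_mat 1 n" for u
  proof -
    have "(u - w) * M + x = (u - w + w) * M + y" using u w by (intro 1) auto
    also have "u - w + w = u" using u w by (intro eq_matI) auto
    finally show ?thesis ..
  qed
  have sub: "row_coset n M a \<subseteq> row_coset n M b"
    if "\<forall>u\<in>carrier_mat 1 n. \<exists>v\<in>carrier_mat 1 n. u * M + a = v * M + b" for a b
    using that by (auto simp: row_coset_def)
  show "row_coset n M x = row_coset n M y"
  proof (intro equalityI sub ballI)
    fix u :: "int mat" assume u: "u \<in> carrier_mat 1 n"
    show "\<exists>v\<in>carrier_mat 1 n. u * M + x = v * M + y"
      by (rule bexI, rule 1[OF u]) (use u w in auto)
    show "\<exists>v\<in>carrier_mat 1 n. u * M + y = v * M + x"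
      by (rule bexI, rule 2[OF u]) (use u w in auto)
  qed
qed

lemma row_coset_translate:
  assumes M: "M \<in> carrier_mat n n" and "w \<in> carrier_mat 1 n" "y \<in> carrier_mat 1 n"
  shows "row_coset n M (w * M + y) = row_coset n M y"
proof -
  have "w * M + y \<in> carrier_mat 1 n" using assms by auto
  with assms show ?thesis by (auto simp: row_coset_eq_iff)
qed

lemma row_coset_add_cong:
  assumes M: "M \<in> carrier_mat n n" and x: "x \<in> carrier_mat 1 n" "x' \<in> carrier_mat 1 n"
    and y: "y \<in> carrier_mat 1 n" "y' \<in> carrier_mat 1 n"
    and "row_coset n M x = row_coset n M x'" "row_coset n M y = row_coset n M y'"
  shows "row_coset n M (x + y) = row_coset n M (x' + y')"
proof -
  from assms obtain u v where u: "u \<in> carrier_mat 1 n" "x = u * M + x'"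
    and v: "v \<in> carrier_mat 1 n" "y = v * M + y'" by (auto simp: row_coset_eq_iff)
  have "x + y = (u * M + v * M) + (x' + y')"
    unfolding u(2) v(2) using u(1) v(1) x y M by (intro eq_matI) (auto simp: algebra_simps)
  also have "u * M + v * M = (u + v) * M"
    using u v M by (intro add_mult_distrib_mat[symmetric]) auto
  finally show ?thesis using u v x y M by (simp add: row_coset_translate)
qed

text \<open>Multiplication by \<open>Q\<close> descends to the quotient because it maps \<open>\<int>\<^sup>n M\<close> into itself:
  \<open>u M Q = (u Q) M\<close>.\<close>

lemma row_coset_mult_cong:
  assumes M: "M \<in> carrier_mat n n" and Q: "Q \<in> carrier_mat n n" and MQ: "M * Q = Q * M"
    and x: "x \<in> carrier_mat 1 n" "y \<in> carrier_mat 1 n" and eq: "row_coset n M x = row_coset n M y"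
  shows "row_coset n M (x * Q) = row_coset n M (y * Q)"
proof -
  from assms obtain u where u: "u \<in> carrier_mat 1 n" "x = u * M + y" by (auto simp: row_coset_eq_iff)
  have "x * Q = u * M * Q + y * Q"
    unfolding u(2) using u M Q x by (intro add_mult_distrib_mat) auto
  also have "u * M * Q = u * Q * M"
    using assoc_mult_mat[OF u(1) M Q] assoc_mult_mat[OF u(1) Q M] MQ by simp
  finally have "x * Q = u * Q * M + y * Q" .
  moreover have "u * Q \<in> carrier_mat 1 n" "y * Q \<in> carrier_mat 1 n" using u(1) x Q by auto
  ultimately show ?thesis using row_coset_translate[OF M] by simp
qed

text \<open>Right multiples generate smaller lattices: \<open>\<int>\<^sup>n S M \<subseteq> \<int>\<^sup>n M\<close>.\<close>

lemma row_coset_coarsen: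
  assumes S: "S \<in> carrier_mat n n" and M: "M \<in> carrier_mat n n"
    and x: "x \<in> carrier_mat 1 n" "y \<in> carrier_mat 1 n"
    and eq: "row_coset n (S * M) x = row_coset n (S * M) y"
  shows "row_coset n M x = row_coset n M y"
proof -
  from eq x S M obtain u where u: "u \<in> carrier_mat 1 n" "x = u * (S * M) + y"
    by (auto simp: row_coset_eq_iff[of "S * M"])
  then have "x = u * S * M + y" using assoc_mult_mat[OF u(1) S M] by simp
  moreover have "u * S \<in> carrier_mat 1 n" using u(1) S by auto
  ultimately show ?thesis using row_coset_translate[OF M _ x(2)] by simp
qed

text \<open>The maps between quotients are defined as unions over all representatives of a coset. When the
  summands agree, the union is its value at any representative.\<close>

lemma Union_row_coset:
  assumes "M \<in> carrier_mat n n" "x \<in> carrier_mat 1 n"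
    and "\<And>y. y \<in> carrier_mat 1 n \<Longrightarrow> row_coset n M y = row_coset n M x \<Longrightarrow> F y = F x"
  shows "(\<Union>y\<in>row_coset n M x. F y) = F x"
proof -
  have "F y = F x" if "y \<in> row_coset n M x" for y
  proof -
    from that obtain w where w: "w \<in> carrier_mat 1 n" "y = w * M + x" by (auto simp: row_coset_def)
    with assms show ?thesis by (intro assms(3)) (auto simp: row_coset_translate)
  qed
  with row_coset_self[OF assms(1,2)] show ?thesis by blast
qed

lemma row_module_simps:
  "carrier (row_module n A) = carrier_mat 1 n"
  "add (row_module n A) = (+)"
  "r \<odot>\<^bsub>row_module n A\<^esub> x = x * poly_mat n (SOME q. q \<in> r) A"
  by (simp_all add: row_module_def)

lemma row_module_coset: "row_image n M +>\<^bsub>row_module n A\<^esub> x = row_coset n M x"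
  unfolding a_r_coset_def' row_module_simps row_image_def row_coset_def by blast

lemma quotient_module_simps:
  "carrier (quotient_module M N) = (\<lambda>x. N +>\<^bsub>M\<^esub> x) ` carrier M"
  "X \<oplus>\<^bsub>quotient_module M N\<^esub> Y = X <+>\<^bsub>M\<^esub> Y"
  "r \<odot>\<^bsub>quotient_module M N\<^esub> X = (\<Union>m\<in>X. N +>\<^bsub>M\<^esub> (r \<odot>\<^bsub>M\<^esub> m))"
  unfolding quotient_module_def A_RCOSETS_def'
  by (simp_all only: module.simps partial_object.simps ring.simps UNION_singleton_eq_range)

lemma carrier_quotient:
  "carrier (quotient_module (row_module n A) (row_image n M)) = row_coset n M ` carrier_mat 1 n"
  unfolding quotient_module_simps row_module_coset row_module_simps ..

lemma add_quotient:
  assumes M: "M \<in> carrier_mat n n" and x: "x \<in> carrier_mat 1 n" and y: "y \<in> carrier_mat 1 n"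
  shows "row_coset n M x \<oplus>\<^bsub>quotient_module (row_module n A) (row_image n M)\<^esub> row_coset n M y
    = row_coset n M (x + y)"
proof -
  have 1: "(u * M + x) + (v * M + y) = (u + v) * M + (x + y)"
    if "u \<in> carrier_mat 1 n" "v \<in> carrier_mat 1 n" for u v
  proof -
    have "(u * M + x) + (v * M + y) = (u * M + v * M) + (x + y)"
      using that x y M by (intro eq_matI) (auto simp: algebra_simps)
    also have "u * M + v * M = (u + v) * M"
      using that M by (intro add_mult_distrib_mat[symmetric]) auto
    finally show ?thesis .
  qed
  have "{a + b | a b. a \<in> row_coset n M x \<and> b \<in> row_coset n M y} = row_coset n M (x + y)"
  proof (intro equalityI subsetI)
    fix z assume "z \<in> row_coset n M (x + y)"
    then obtain u where u: "u \<in> carrier_mat 1 n" "z = u * M + (x + y)" by (auto simp: row_coset_def)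
    then have "z = (u * M + x) + y"
      using x y M by (auto simp: assoc_add_mat[of _ 1 n])
    moreover have "u * M + x \<in> row_coset n M x" using u by (auto simp: row_coset_def)
    ultimately show "z \<in> {a + b | a b. a \<in> row_coset n M x \<and> b \<in> row_coset n M y}"
      using row_coset_self[OF M y] by blast
  next
    fix z assume "z \<in> {a + b | a b. a \<in> row_coset n M x \<and> b \<in> row_coset n M y}"
    then obtain u v where uv: "u \<in> carrier_mat 1 n" "v \<in> carrier_mat 1 n"
      and "z = (u * M + x) + (v * M + y)" by (auto simp: row_coset_def)
    then have "z = (u + v) * M + (x + y)" by (simp only: 1)
    moreover have "u + v \<in> carrier_mat 1 n" using uv by simp
    ultimately show "z \<in> row_coset n M (x + y)" by (auto simp: row_coset_def)
  qed
  then show ?thesis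
    unfolding quotient_module_simps set_add_def' row_module_simps by (simp only: set_eq_iff) blast
qed

lemma smult_quotient:
  assumes A: "A \<in> carrier_mat n n" and x: "x \<in> carrier_mat 1 n"
  shows "r \<odot>\<^bsub>quotient_module (row_module n A) (row_image n (mat_eval n p A))\<^esub> row_coset n (mat_eval n p A) x
    = row_coset n (mat_eval n p A) (x * mat_eval n (SOME q. q \<in> r) A)"
proof -
  let ?M = "mat_eval n p A" and ?Q = "mat_eval n (SOME q. q \<in> r) A"
  have "(\<Union>y\<in>row_coset n ?M x. row_coset n ?M (y * ?Q)) = row_coset n ?M (x * ?Q)"
    using A x by (intro Union_row_coset row_coset_mult_cong mat_eval_commute mult_carrier_mat) auto
  then show ?thesis
    unfolding quotient_module_simps row_module_coset row_module_simps poly_mat_eq_mat_eval[OF A] .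
qed

text \<open>With \<open>d = det M\<close>, the adjugate gives \<open>d y = y adj(M) M\<close>, so the lattice contains
  \<open>d \<int>\<^sup>n\<close> and each coset has a representative with entries reduced modulo \<open>d\<close>.\<close>

lemma finite_row_cosets:
  assumes M: "M \<in> carrier_mat n n" and "det M \<noteq> 0"
  shows "finite (row_coset n M ` carrier_mat 1 n)"
proof -
  define d where "d = det M"
  let ?red = "\<lambda>x :: int mat. mat 1 n (\<lambda>ij. x $$ ij mod d)"
  \<comment> \<open>The sign of \<open>d\<close> is unknown and the remainder takes that sign, hence the symmetric range.\<close>
  let ?R = "(\<lambda>f. mat 1 n (\<lambda>(i, j). f j)) ` ({..<n} \<rightarrow>\<^sub>E {- \<bar>d\<bar>..\<bar>d\<bar>})"
  have "row_coset n M x \<in> row_coset n M ` ?R" if x: "x \<in> carrier_mat 1 n" for x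
  proof -
    let ?y = "mat 1 n (\<lambda>ij. x $$ ij div d)"
    have "?red x = mat 1 n (\<lambda>(i, j). (\<lambda>j\<in>{..<n}. x $$ (0, j) mod d) j)"
      by (intro eq_matI) auto
    moreover have "- \<bar>d\<bar> \<le> k mod d \<and> k mod d \<le> \<bar>d\<bar>" for k
      using assms(2) abs_mod_less[of d k] by (simp add: d_def abs_less_iff)
    then have "(\<lambda>j\<in>{..<n}. x $$ (0, j) mod d) \<in> {..<n} \<rightarrow>\<^sub>E {- \<bar>d\<bar>..\<bar>d\<bar>}"
      by auto
    ultimately have R: "?red x \<in> ?R" by blast
    have y: "?y \<in> carrier_mat 1 n" by simp
    have "?y * adj_mat M * M = ?y * (d \<cdot>\<^sub>m 1\<^sub>m n)"
      using assoc_mult_mat[OF y adj_mat(1)[OF M] M] adj_mat(3)[OF M] by (simp add: d_def)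
    also have "\<dots> = d \<cdot>\<^sub>m ?y"
      using mult_smult_distrib[OF y one_carrier_mat] y by simp
    finally have "x = ?y * adj_mat M * M + ?red x"
      using x by (simp only:) (intro eq_matI, auto)
    moreover have "?y * adj_mat M \<in> carrier_mat 1 n" using adj_mat(1)[OF M] by auto
    ultimately have "row_coset n M x = row_coset n M (?red x)"
      using row_coset_translate[OF M, of "?y * adj_mat M" "?red x"] by simp
    with R show ?thesis by blast
  qed
  then have "row_coset n M ` carrier_mat 1 n \<subseteq> row_coset n M ` ?R" by blast
  moreover have "finite ?R" by (intro finite_imageI finite_PiE) auto
  ultimately show ?thesis by (meson finite_imageI finite_subset)
qed

section \<open>The finite levels\<close>

definition level_poly :: "nat \<Rightarrow> int poly" where
  "level_poly k = monom 1 (fact k) - 1"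

definition level_coset :: "nat \<Rightarrow> int mat \<Rightarrow> nat \<Rightarrow> int mat \<Rightarrow> int mat set" where
  "level_coset n A k = row_coset n (mat_eval n (level_poly k) A)"

text \<open>\<open>l!\<close> divides \<open>k!\<close>, and \<open>y - 1\<close> divides \<open>y\<^bsup>b\<^esup> - 1\<close> for \<open>y = x\<^bsup>l!\<^esup>\<close>.\<close>

lemma level_poly_dvd:
  assumes "l \<le> k"
  shows "level_poly l dvd level_poly k"
proof -
  from assms have "fact l dvd (fact k :: nat)" by (rule fact_dvd)
  then obtain b :: nat where b: "fact k = fact l * b" by blast
  have "level_poly k = monom 1 (fact l) ^ b - 1"
    by (simp add: level_poly_def b monom_power)
  also have "\<dots> = level_poly l * (\<Sum>i<b. monom 1 (fact l) ^ i)"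
    by (simp only: power_diff_1_eq level_poly_def)
  finally show ?thesis by simp
qed

context
  fixes n :: nat and A :: "int mat"
  assumes A: "A \<in> carrier_mat n n"
begin

lemma level_coset_translate:
  assumes "u \<in> carrier_mat 1 n" "x \<in> carrier_mat 1 n"
  shows "level_coset n A k (u * mat_eval n (level_poly k) A + x) = level_coset n A k x"
  unfolding level_coset_def using A assms by (intro row_coset_translate) auto

lemma level_cosetE:
  assumes "x \<in> carrier_mat 1 n" "y \<in> carrier_mat 1 n" and "level_coset n A k x = level_coset n A k y"
  obtains u where "u \<in> carrier_mat 1 n" "x = u * mat_eval n (level_poly k) A + y"
  using assms A by (auto simp: level_coset_def row_coset_eq_iff)

lemma level_coset_coarsen:
  assumes "l \<le> k" and x: "x \<in> carrier_mat 1 n" "y \<in> carrier_mat 1 n"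
    and eq: "level_coset n A k x = level_coset n A k y"
  shows "level_coset n A l x = level_coset n A l y"
proof -
  obtain r where r: "level_poly k = level_poly l * r" using level_poly_dvd[OF assms(1)] by blast
  have "mat_eval n (level_poly k) A = mat_eval n r A * mat_eval n (level_poly l) A"
    unfolding r by (rule mat_eval_mult[OF A])
  with eq show ?thesis
    unfolding level_coset_def
    by (metis row_coset_coarsen[OF mat_eval_carrier[OF A] mat_eval_carrier[OF A] x])
qed

lemma level_coset_add_cong:
  assumes "x \<in> carrier_mat 1 n" "x' \<in> carrier_mat 1 n" "y \<in> carrier_mat 1 n" "y' \<in> carrier_mat 1 n"
    and "level_coset n A k x = level_coset n A k x'" "level_coset n A k y = level_coset n A k y'"
  shows "level_coset n A k (x + y) = level_coset n A k (x' + y')"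
  using assms A unfolding level_coset_def by (intro row_coset_add_cong) auto

lemma level_coset_mult_cong:
  assumes "x \<in> carrier_mat 1 n" "y \<in> carrier_mat 1 n" and "level_coset n A k x = level_coset n A k y"
  shows "level_coset n A k (x * mat_eval n q A) = level_coset n A k (y * mat_eval n q A)"
  using assms A unfolding level_coset_def by (intro row_coset_mult_cong mat_eval_commute) auto

lemma N_level_eq: "N_level n A k = row_image n (mat_eval n (level_poly k) A)"
  by (simp add: N_level_def level_poly_def mat_eval_pow_minus_one[OF A])

lemma G_level_eq: "G_level n A k = quotient_module (row_module n A) (row_image n (mat_eval n (level_poly k) A))"
  by (simp add: G_level_def N_level_eq)

text \<open>The bridge from the hypothesis on the modules \<open>BF\<close> to the inverse system.\<close>

lemma G_level_eq_BF: "G_level n A k = BF n (level_poly k) A"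
  by (simp add: G_level_eq BF_def poly_mat_eq_mat_eval[OF A])

lemma carrier_G_level: "carrier (G_level n A k) = level_coset n A k ` carrier_mat 1 n"
  by (simp add: G_level_eq carrier_quotient level_coset_def)

lemma add_G_level:
  assumes "x \<in> carrier_mat 1 n" "y \<in> carrier_mat 1 n"
  shows "level_coset n A k x \<oplus>\<^bsub>G_level n A k\<^esub> level_coset n A k y = level_coset n A k (x + y)"
  unfolding G_level_eq level_coset_def using A assms by (intro add_quotient) auto

lemma smult_G_level:
  assumes "x \<in> carrier_mat 1 n"
  shows "r \<odot>\<^bsub>G_level n A k\<^esub> level_coset n A k x = level_coset n A k (x * mat_eval n (SOME q. q \<in> r) A)"
  unfolding G_level_eq level_coset_def using A assms by (intro smult_quotient) auto

lemma G_proj_level_coset: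
  assumes "l \<le> k" "x \<in> carrier_mat 1 n"
  shows "G_proj n A k l (level_coset n A k x) = level_coset n A l x"
proof -
  have "(\<Union>y\<in>level_coset n A k x. level_coset n A l y) = level_coset n A l x"
    unfolding level_coset_def[of n A k]
  proof (rule Union_row_coset)
    fix y assume "y \<in> carrier_mat 1 n"
      "row_coset n (mat_eval n (level_poly k) A) y = row_coset n (mat_eval n (level_poly k) A) x"
    with assms show "level_coset n A l y = level_coset n A l x"
      by (intro level_coset_coarsen[of l k]) (auto simp: level_coset_def)
  qed (use A assms in auto)
  then show ?thesis by (simp add: G_proj_def N_level_eq row_module_coset level_coset_def)
qed

lemma finite_G_level:
  assumes "hyperbolic A"
  shows "finite (carrier (G_level n A k))"
proof -
  have "det (mat_eval n (level_poly k) A) \<noteq> 0"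
    using det_pow_minus_one_nonzero[OF A assms] by (simp add: level_poly_def mat_eval_pow_minus_one[OF A])
  then show ?thesis
    unfolding carrier_G_level level_coset_def using A by (intro finite_row_cosets) auto
qed

end

section \<open>Isomorphisms between levels\<close>

text \<open>The map \<open>\<psi>\<close> is a lift of an \<open>R\<close>-isomorphism between the \<open>k\<close>-th levels: modulo the
  lattice at level \<open>k\<close> it is additive, intertwines \<open>q(A)\<close> with \<open>q(B)\<close>, and is well defined,
  injective and surjective on cosets. The fourth clause says well-definedness and injectivity at
  once. Only the behaviour modulo the lattice is constrained, so a lift exists for every
  isomorphism.\<close>

definition level_isomorphism :: "nat \<Rightarrow> int mat \<Rightarrow> int mat \<Rightarrow> nat \<Rightarrow> (int mat \<Rightarrow> int mat) \<Rightarrow> bool" where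
  "level_isomorphism n A B k \<psi> \<longleftrightarrow>
     \<psi> \<in> carrier_mat 1 n \<rightarrow> carrier_mat 1 n \<and>
     (\<forall>x\<in>carrier_mat 1 n. \<forall>y\<in>carrier_mat 1 n.
        level_coset n B k (\<psi> (x + y)) = level_coset n B k (\<psi> x + \<psi> y)) \<and>
     (\<forall>q. \<forall>x\<in>carrier_mat 1 n.
        level_coset n B k (\<psi> (x * mat_eval n q A)) = level_coset n B k (\<psi> x * mat_eval n q B)) \<and>
     (\<forall>x\<in>carrier_mat 1 n. \<forall>y\<in>carrier_mat 1 n.
        level_coset n B k (\<psi> x) = level_coset n B k (\<psi> y) \<longleftrightarrow> level_coset n A k x = level_coset n A k y) \<and>
     (\<forall>w\<in>carrier_mat 1 n. \<exists>x\<in>carrier_mat 1 n. level_coset n B k (\<psi> x) = level_coset n B k w)"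

lemma level_isomorphismD:
  assumes "level_isomorphism n A B k \<psi>"
  shows "x \<in> carrier_mat 1 n \<Longrightarrow> \<psi> x \<in> carrier_mat 1 n"
    and "x \<in> carrier_mat 1 n \<Longrightarrow> y \<in> carrier_mat 1 n
      \<Longrightarrow> level_coset n B k (\<psi> (x + y)) = level_coset n B k (\<psi> x + \<psi> y)"
    and "x \<in> carrier_mat 1 n
      \<Longrightarrow> level_coset n B k (\<psi> (x * mat_eval n q A)) = level_coset n B k (\<psi> x * mat_eval n q B)"
    and "x \<in> carrier_mat 1 n \<Longrightarrow> y \<in> carrier_mat 1 n
      \<Longrightarrow> level_coset n B k (\<psi> x) = level_coset n B k (\<psi> y) \<longleftrightarrow> level_coset n A k x = level_coset n A k y"
    and "w \<in> carrier_mat 1 n \<Longrightarrow> \<exists>x\<in>carrier_mat 1 n. level_coset n B k (\<psi> x) = level_coset n B k w"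
proof -
  note * = assms[unfolded level_isomorphism_def]
  show "x \<in> carrier_mat 1 n \<Longrightarrow> \<psi> x \<in> carrier_mat 1 n"
    using *[THEN conjunct1] by (rule funcset_mem)
  show "x \<in> carrier_mat 1 n \<Longrightarrow> y \<in> carrier_mat 1 n
      \<Longrightarrow> level_coset n B k (\<psi> (x + y)) = level_coset n B k (\<psi> x + \<psi> y)"
    by (rule *[THEN conjunct2, THEN conjunct1, rule_format])
  show "x \<in> carrier_mat 1 n
      \<Longrightarrow> level_coset n B k (\<psi> (x * mat_eval n q A)) = level_coset n B k (\<psi> x * mat_eval n q B)"
    by (rule *[THEN conjunct2, THEN conjunct2, THEN conjunct1, rule_format])
  show "x \<in> carrier_mat 1 n \<Longrightarrow> y \<in> carrier_mat 1 n
      \<Longrightarrow> level_coset n B k (\<psi> x) = level_coset n B k (\<psi> y) \<longleftrightarrow> level_coset n A k x = level_coset n A k y"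
    by (rule *[THEN conjunct2, THEN conjunct2, THEN conjunct2, THEN conjunct1, rule_format])
  show "w \<in> carrier_mat 1 n \<Longrightarrow> \<exists>x\<in>carrier_mat 1 n. level_coset n B k (\<psi> x) = level_coset n B k w"
    by (rule *[THEN conjunct2, THEN conjunct2, THEN conjunct2, THEN conjunct2, rule_format])
qed

text \<open>Modulo level \<open>k\<close>, the lift carries \<open>u g\<^sub>l(A)\<close> to \<open>\<psi>(u) g\<^sub>l(B)\<close>, so it maps the lattice
  of \<open>A\<close> at level \<open>l\<close> into that of \<open>B\<close>. Surjectivity at level \<open>k\<close> shows that it maps onto the
  latter, because any \<open>w g\<^sub>l(B)\<close> agrees at level \<open>k\<close> with \<open>\<psi>(u) g\<^sub>l(B)\<close> for some \<open>u\<close>. Hence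
  it is well defined and injective at level \<open>l\<close>; the remaining clauses are inherited by coarsening
  cosets.\<close>

lemma level_isomorphism_descend:
  assumes A: "A \<in> carrier_mat n n" and B: "B \<in> carrier_mat n n"
    and \<psi>: "level_isomorphism n A B k \<psi>" and "l \<le> k"
  shows "level_isomorphism n A B l \<psi>"
proof -
  note \<psi>D = level_isomorphismD[OF \<psi>]
  note coarsenA = level_coset_coarsen[OF A \<open>l \<le> k\<close>]
  note coarsenB = level_coset_coarsen[OF B \<open>l \<le> k\<close>]
  let ?MA = "mat_eval n (level_poly l) A" and ?MB = "mat_eval n (level_poly l) B"
  have V: "x * mat_eval n q A \<in> carrier_mat 1 n" "x * mat_eval n q B \<in> carrier_mat 1 n"
    if "x \<in> carrier_mat 1 n" for x q using that A B by auto
  have shift: "level_coset n B k (\<psi> (u * ?MA + y)) = level_coset n B k (\<psi> u * ?MB + \<psi> y)"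
    if u: "u \<in> carrier_mat 1 n" and y: "y \<in> carrier_mat 1 n" for u y
  proof -
    have "level_coset n B k (\<psi> (u * ?MA + y)) = level_coset n B k (\<psi> (u * ?MA) + \<psi> y)"
      using u y V by (intro \<psi>D(2)) auto
    also have "\<dots> = level_coset n B k (\<psi> u * ?MB + \<psi> y)"
      using u y V \<psi>D(1) by (intro level_coset_add_cong[OF B] \<psi>D(3)) auto
    finally show ?thesis .
  qed
  have iff: "level_coset n B l (\<psi> x) = level_coset n B l (\<psi> y) \<longleftrightarrow> level_coset n A l x = level_coset n A l y"
    if x: "x \<in> carrier_mat 1 n" and y: "y \<in> carrier_mat 1 n" for x y
  proof
    assume "level_coset n A l x = level_coset n A l y"
    then obtain u where u: "u \<in> carrier_mat 1 n" and xu: "x = u * ?MA + y"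
      by (rule level_cosetE[OF A x y])
    have "level_coset n B l (\<psi> x) = level_coset n B l (\<psi> u * ?MB + \<psi> y)"
      using u x y V \<psi>D(1) shift[OF u y] by (intro coarsenB) (auto simp: xu)
    also have "\<dots> = level_coset n B l (\<psi> y)"
      using u y \<psi>D(1) by (intro level_coset_translate[OF B]) auto
    finally show "level_coset n B l (\<psi> x) = level_coset n B l (\<psi> y)" .
  next
    assume "level_coset n B l (\<psi> x) = level_coset n B l (\<psi> y)"
    then obtain w where w: "w \<in> carrier_mat 1 n" and xw: "\<psi> x = w * ?MB + \<psi> y"
      by (rule level_cosetE[OF B \<psi>D(1)[OF x] \<psi>D(1)[OF y]])
    obtain u where u: "u \<in> carrier_mat 1 n" and uw: "level_coset n B k (\<psi> u) = level_coset n B k w"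
      using \<psi>D(5)[OF w] by blast
    have "level_coset n B k (\<psi> (u * ?MA + y)) = level_coset n B k (\<psi> u * ?MB + \<psi> y)"
      by (rule shift[OF u y])
    also have "\<dots> = level_coset n B k (w * ?MB + \<psi> y)"
      using u w y uw V \<psi>D(1)
      by (intro level_coset_add_cong[OF B] level_coset_mult_cong[OF B]) auto
    finally have "level_coset n A k (u * ?MA + y) = level_coset n A k x"
      using u x y V \<psi>D(4)[of "u * ?MA + y" x] by (simp add: xw)
    then have "level_coset n A l (u * ?MA + y) = level_coset n A l x"
      using u x y V by (intro coarsenA) auto
    then show "level_coset n A l x = level_coset n A l y"
      using level_coset_translate[OF A u y] by simp
  qed
  show ?thesis
    unfolding level_isomorphism_def
  proof (intro conjI ballI allI iff)
    show "\<psi> \<in> carrier_mat 1 n \<rightarrow> carrier_mat 1 n" using \<psi>D(1) by auto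
  next
    fix x y :: "int mat" assume "x \<in> carrier_mat 1 n" "y \<in> carrier_mat 1 n"
    then show "level_coset n B l (\<psi> (x + y)) = level_coset n B l (\<psi> x + \<psi> y)"
      using \<psi>D(1) by (intro coarsenB \<psi>D(2)) auto
  next
    fix q and x :: "int mat" assume "x \<in> carrier_mat 1 n"
    then show "level_coset n B l (\<psi> (x * mat_eval n q A)) = level_coset n B l (\<psi> x * mat_eval n q B)"
      using \<psi>D(1) V by (intro coarsenB \<psi>D(3)) auto
  next
    fix w :: "int mat" assume w: "w \<in> carrier_mat 1 n"
    then obtain x where "x \<in> carrier_mat 1 n" "level_coset n B k (\<psi> x) = level_coset n B k w"
      using \<psi>D(5) by blast
    with w show "\<exists>x\<in>carrier_mat 1 n. level_coset n B l (\<psi> x) = level_coset n B l w"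
      using \<psi>D(1) coarsenB by blast
  qed
qed

text \<open>Choosing a representative of the image of each coset lifts \<open>h\<close>. The common annihilator
  ensures that the coset of \<open>q\<close> acts as \<open>q(A)\<close> on one side and as \<open>q(B)\<close> on the other.\<close>

lemma level_isomorphism_exists:
  assumes A: "A \<in> carrier_mat n n" and B: "B \<in> carrier_mat n n"
    and ann: "annihilator n A = annihilator n B"
    and h: "h \<in> module_iso (poly_ring_mod n A) (G_level n A k) (G_level n B k)"
  shows "\<exists>\<psi>. level_isomorphism n A B k \<psi>"
proof -
  let ?cA = "level_coset n A k" and ?cB = "level_coset n B k"
  note carA = carrier_G_level[OF A, of k] and carB = carrier_G_level[OF B, of k]
  have hom: "h (X \<oplus>\<^bsub>G_level n A k\<^esub> Y) = h X \<oplus>\<^bsub>G_level n B k\<^esub> h Y"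
    if "X \<in> carrier (G_level n A k)" "Y \<in> carrier (G_level n A k)" for X Y
    using h that by (auto simp: module_iso_def LinearCombinations.module_hom_def)
  have smult: "h (r \<odot>\<^bsub>G_level n A k\<^esub> X) = r \<odot>\<^bsub>G_level n B k\<^esub> h X"
    if "r \<in> carrier (poly_ring_mod n A)" "X \<in> carrier (G_level n A k)" for r X
    using h that by (auto simp: module_iso_def LinearCombinations.module_hom_def)
  have bij: "bij_betw h (?cA ` carrier_mat 1 n) (?cB ` carrier_mat 1 n)"
    using h by (simp add: module_iso_def carA carB)
  have "\<forall>x\<in>carrier_mat 1 n. \<exists>w. w \<in> carrier_mat 1 n \<and> ?cB w = h (?cA x)"
    using bij_betwE[OF bij] by (metis imageE imageI)
  from bchoice[OF this] obtain \<psi> where \<psi>: "\<And>x. x \<in> carrier_mat 1 n \<Longrightarrow> \<psi> x \<in> carrier_mat 1 n"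
    "\<And>x. x \<in> carrier_mat 1 n \<Longrightarrow> ?cB (\<psi> x) = h (?cA x)"
    by blast
  have "level_isomorphism n A B k \<psi>"
    unfolding level_isomorphism_def
  proof (intro conjI ballI allI)
    show "\<psi> \<in> carrier_mat 1 n \<rightarrow> carrier_mat 1 n" using \<psi>(1) by auto
  next
    fix x y :: "int mat" assume xy: "x \<in> carrier_mat 1 n" "y \<in> carrier_mat 1 n"
    have "?cB (\<psi> (x + y)) = h (?cA x \<oplus>\<^bsub>G_level n A k\<^esub> ?cA y)"
      using xy by (simp add: \<psi>(2) add_G_level[OF A])
    also have "\<dots> = ?cB (\<psi> x) \<oplus>\<^bsub>G_level n B k\<^esub> ?cB (\<psi> y)"
      using xy by (subst hom) (auto simp: carA \<psi>(2))
    also have "\<dots> = ?cB (\<psi> x + \<psi> y)"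
      using xy \<psi>(1) by (intro add_G_level[OF B]) auto
    finally show "?cB (\<psi> (x + y)) = ?cB (\<psi> x + \<psi> y)" .
  next
    fix q and x :: "int mat" assume x: "x \<in> carrier_mat 1 n"
    let ?r = "annihilator n A +>\<^bsub>class_ring\<^esub> q"
    have r: "?r \<in> carrier (poly_ring_mod n A)"
      unfolding poly_ring_mod_def FactRing_def A_RCOSETS_def' partial_object.simps
      by (rule UN_I[of q], rule UNIV_I, rule singletonI)
    have "x * mat_eval n q A \<in> carrier_mat 1 n" using x A by auto
    then have "?cB (\<psi> (x * mat_eval n q A)) = h (?r \<odot>\<^bsub>G_level n A k\<^esub> ?cA x)"
      using x by (simp add: \<psi>(2) smult_G_level[OF A] mat_eval_some_in_annihilator_coset[OF A])
    also have "\<dots> = ?r \<odot>\<^bsub>G_level n B k\<^esub> ?cB (\<psi> x)"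
      using x by (subst smult[OF r]) (auto simp: carA \<psi>(2))
    also have "\<dots> = ?cB (\<psi> x * mat_eval n q B)"
      using smult_G_level[OF B \<psi>(1)[OF x]] by (simp add: ann mat_eval_some_in_annihilator_coset[OF B])
    finally show "?cB (\<psi> (x * mat_eval n q A)) = ?cB (\<psi> x * mat_eval n q B)" .
  next
    fix x y :: "int mat" assume "x \<in> carrier_mat 1 n" "y \<in> carrier_mat 1 n"
    then show "?cB (\<psi> x) = ?cB (\<psi> y) \<longleftrightarrow> ?cA x = ?cA y"
      using inj_on_eq_iff[OF bij_betw_imp_inj_on[OF bij], of "?cA x" "?cA y"] by (simp add: \<psi>(2))
  next
    fix w :: "int mat" assume "w \<in> carrier_mat 1 n"
    then have "?cB w \<in> h ` ?cA ` carrier_mat 1 n"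
      using bij_betw_imp_surj_on[OF bij] by simp
    then obtain x where x: "x \<in> carrier_mat 1 n" and "?cB w = h (?cA x)" by blast
    with \<psi>(2)[OF x] have "?cB (\<psi> x) = ?cB w" by simp
    with x show "\<exists>x\<in>carrier_mat 1 n. ?cB (\<psi> x) = ?cB w" ..
  qed
  then show ?thesis by blast
qed

lemma level_isomorphism_factors:
  assumes A: "A \<in> carrier_mat n n" and B: "B \<in> carrier_mat n n"
    and \<psi>: "level_isomorphism n A B k \<psi>"
  obtains F where "F \<in> carrier (G_level n A k) \<rightarrow>\<^sub>E carrier (G_level n B k)"
    and "\<And>x. x \<in> carrier_mat 1 n \<Longrightarrow> F (level_coset n A k x) = level_coset n B k (\<psi> x)"
proof -
  have "\<exists>Y. \<forall>x\<in>carrier_mat 1 n. level_coset n A k x = X \<longrightarrow> Y = level_coset n B k (\<psi> x)" for X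
    using level_isomorphismD(4)[OF \<psi>] by metis
  then obtain F where F: "\<And>x. x \<in> carrier_mat 1 n \<Longrightarrow> F (level_coset n A k x) = level_coset n B k (\<psi> x)"
    by metis
  show thesis
  proof (rule that)
    show "restrict F (carrier (G_level n A k)) \<in> carrier (G_level n A k) \<rightarrow>\<^sub>E carrier (G_level n B k)"
      using F level_isomorphismD(1)[OF \<psi>] by (auto simp: carrier_G_level[OF A] carrier_G_level[OF B])
    show "restrict F (carrier (G_level n A k)) (level_coset n A k x) = level_coset n B k (\<psi> x)"
      if "x \<in> carrier_mat 1 n" for x
      using that F[OF that] unfolding carrier_G_level[OF A] by (simp only: restrict_apply' imageI)
  qed
qed

text \<open>There are infinitely many lifts, but the map on cosets that a lift induces is one of the finitely
  many maps between two finite sets.\<close>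

lemma finite_level_isomorphism_classes:
  assumes A: "A \<in> carrier_mat n n" and B: "B \<in> carrier_mat n n"
    and hyp: "hyperbolic A" "hyperbolic B"
  shows "finite ((\<lambda>\<psi>. \<lambda>x\<in>carrier_mat 1 n. level_coset n B k (\<psi> x)) ` {\<psi>. level_isomorphism n A B k \<psi>})"
proof -
  let ?V = "carrier_mat 1 n :: int mat set"
  let ?GA = "carrier (G_level n A k)" and ?GB = "carrier (G_level n B k)"
  have "(\<lambda>x\<in>?V. level_coset n B k (\<psi> x)) \<in> (\<lambda>F. \<lambda>x\<in>?V. F (level_coset n A k x)) ` (?GA \<rightarrow>\<^sub>E ?GB)"
    if \<psi>: "level_isomorphism n A B k \<psi>" for \<psi>
  proof -
    obtain F where F: "F \<in> ?GA \<rightarrow>\<^sub>E ?GB"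
      and val: "\<And>x. x \<in> ?V \<Longrightarrow> F (level_coset n A k x) = level_coset n B k (\<psi> x)"
      using level_isomorphism_factors[OF A B \<psi>] by blast
    have "(\<lambda>x\<in>?V. level_coset n B k (\<psi> x)) = (\<lambda>x\<in>?V. F (level_coset n A k x))"
      using val by (intro restrict_ext) simp
    with F show ?thesis by blast
  qed
  then have "(\<lambda>\<psi>. \<lambda>x\<in>?V. level_coset n B k (\<psi> x)) ` {\<psi>. level_isomorphism n A B k \<psi>}
      \<subseteq> (\<lambda>F. \<lambda>x\<in>?V. F (level_coset n A k x)) ` (?GA \<rightarrow>\<^sub>E ?GB)" by blast
  moreover have "finite (?GA \<rightarrow>\<^sub>E ?GB)"
    using finite_G_level[OF A] finite_G_level[OF B] hyp by (intro finite_PiE) auto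
  ultimately show ?thesis by (meson finite_imageI finite_subset)
qed

section \<open>Coherent choices\<close>

text \<open>Koenig's lemma in the form needed here. The value \<open>r k x\<close> is the trace of \<open>x\<close> at level \<open>k\<close>, and the
  claim is that solutions at all levels can be chosen so that their traces at lower levels agree.
  Start from any sequence \<open>y\<close> of solutions. At each level the tail of \<open>y\<close> has finitely
  many traces, so some subsequence has a constant one, and a diagonal subsequence eventually has
  constant trace at all levels simultaneously.\<close>

lemma koenig_coherent_choice:
  fixes P :: "nat \<Rightarrow> 'a \<Rightarrow> bool" and r :: "nat \<Rightarrow> 'a \<Rightarrow> 'b"
  assumes ex: "\<And>k. \<exists>x. P k x"
    and down: "\<And>k l x. P k x \<Longrightarrow> l \<le> k \<Longrightarrow> P l x"
    and fin: "\<And>k. finite (r k ` {x. P k x})"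
  obtains x where "\<And>k. P k (x k)" and "\<And>l k. l \<le> k \<Longrightarrow> r l (x k) = r l (x l)"
proof -
  from ex obtain y where y: "\<And>k. P k (y k)" by metis
  \<comment> \<open>Indices below \<open>k\<close> are exempt, since \<open>y i\<close> solves level \<open>k\<close> only for \<open>i \<ge> k\<close>.\<close>
  define Q where "Q k s \<longleftrightarrow> (\<forall>i j. k \<le> s i \<longrightarrow> k \<le> s j \<longrightarrow> r k (y (s i)) = r k (y (s j)))"
    for k and s :: "nat \<Rightarrow> nat"
  have QD: "r k (y (s i)) = r k (y (s j))" if "Q k s" "k \<le> s i" "k \<le> s j" for k s i j
    using that unfolding Q_def by blast
  interpret subseqs Q
  proof
    fix k and s :: "nat \<Rightarrow> nat" assume s: "strict_mono s"
    have "(\<lambda>i. r k (y (s i))) ` {k..} \<subseteq> r k ` {x. P k x}"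
      using y down strict_mono_imp_increasing[OF s] by (auto intro!: imageI) (meson le_trans)
    then have "finite ((\<lambda>i. r k (y (s i))) ` {k..})" using fin finite_subset by blast
    then obtain c where "infinite {i \<in> {k..}. r k (y (s i)) = c}"
      using pigeonhole_infinite[of "{k..}" "\<lambda>i. r k (y (s i))"] by (auto simp: infinite_Ici)
    then obtain t :: "nat \<Rightarrow> nat" where t: "strict_mono t" "\<And>i. t i \<in> {i \<in> {k..}. r k (y (s i)) = c}"
      using infinite_enumerate by blast
    then have "Q k (s \<circ> t)" by (simp add: Q_def)
    with t(1) show "\<exists>t. strict_mono t \<and> Q k (s \<circ> t)" by blast
  qed
  have diag: "Q k (diagseq \<circ> (+) (Suc k))" for k 
    by (rule diagseq_holds) (unfold Q_def o_def, blast)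
  have const: "r l (y (diagseq (Suc i))) = r l (y (diagseq (Suc j)))"
    if "l \<le> i" "l \<le> j" for l i j
  proof -
    have "l \<le> diagseq (Suc l + m)" for m
      using strict_mono_imp_increasing[OF subseq_diagseq, of "Suc l + m"] by linarith
    then have "r l (y (diagseq (Suc l + (i - l)))) = r l (y (diagseq (Suc l + (j - l))))"
      using QD[OF diag, of l "i - l" "j - l"] by (simp only: o_def)
    with that show ?thesis by simp
  qed
  \<comment> \<open>The trace at level \<open>k\<close> is known to be constant along the diagonal sequence from index \<open>k + 1\<close> on.\<close>
  show thesis
  proof (rule that)
    show "P k (y (diagseq (Suc k)))" for k
      using strict_mono_imp_increasing[OF subseq_diagseq, of "Suc k"]
      by (intro down[OF y]) simp
    show "r l (y (diagseq (Suc k))) = r l (y (diagseq (Suc l)))" if "l \<le> k" for l k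
      using that by (intro const) auto
  qed
qed

section \<open>Coordinatewise homeomorphisms\<close>

text \<open>Every coordinate of \<open>G\<close> is a projection followed by a map out of a discrete space. That
  its values lie in \<open>E k\<close> comes from \<open>G ` S \<subseteq> T\<close>, a condition that the inverse
  of a bijection satisfies by definition.\<close>

lemma continuous_map_coordinatewise:
  assumes "T \<subseteq> Pi\<^sub>E I E" and "G ` S \<subseteq> T" and "S \<subseteq> Pi\<^sub>E I D"
    and G: "\<And>f. f \<in> S \<Longrightarrow> G f = (\<lambda>k\<in>I. F k (f k))"
  shows "continuous_map (subtopology (product_topology (\<lambda>k. discrete_topology (D k)) I) S)
           (subtopology (product_topology (\<lambda>k. discrete_topology (E k)) I) T) G"
proof -
  let ?X = "subtopology (product_topology (\<lambda>k. discrete_topology (D k)) I) S"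
  have S: "topspace ?X = S" using assms(3) by auto
  have "continuous_map ?X (discrete_topology (E k)) (\<lambda>f. G f k)" if k: "k \<in> I" for k
  proof -
    have "continuous_map (product_topology (\<lambda>k. discrete_topology (D k)) I) (discrete_topology UNIV)
        (F k \<circ> (\<lambda>f. f k))"
      by (rule continuous_map_compose[OF continuous_map_product_projection[OF k]]) simp
    then have "continuous_map ?X (discrete_topology UNIV) (F k \<circ> (\<lambda>f. f k))"
      by (rule continuous_map_from_subtopology)
    then have *: "continuous_map ?X (discrete_topology UNIV) (\<lambda>f. G f k)"
      by (rule continuous_map_eq) (use k G S in auto)
    have "(\<lambda>f. G f k) ` topspace ?X \<subseteq> E k"
      unfolding S using assms(1,2) k by auto
    then have "continuous_map ?X (subtopology (discrete_topology UNIV) (E k)) (\<lambda>f. G f k)"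
      using * unfolding continuous_map_in_subtopology by blast
    then show ?thesis by simp
  qed
  moreover have "G ` topspace ?X \<subseteq> extensional I" unfolding S using assms(1,2) by (auto simp: PiE_def)
  ultimately have "continuous_map ?X (product_topology (\<lambda>k. discrete_topology (E k)) I) G"
    by (auto simp: continuous_map_componentwise)
  with assms(2) S show ?thesis by (auto simp: continuous_map_in_subtopology)
qed

text \<open>The inverse of \<open>G\<close> is again coordinatewise: it inverts each \<open>F k\<close> on \<open>D k\<close>.\<close>

lemma homeomorphic_map_coordinatewise:
  assumes S: "S \<subseteq> Pi\<^sub>E I D" and T: "T \<subseteq> Pi\<^sub>E I E" and G_bij: "bij_betw G S T"
    and G: "\<And>f. f \<in> S \<Longrightarrow> G f = (\<lambda>k\<in>I. F k (f k))" and F: "\<And>k. k \<in> I \<Longrightarrow> inj_on (F k) (D k)"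
  shows "homeomorphic_map (subtopology (product_topology (\<lambda>k. discrete_topology (D k)) I) S)
           (subtopology (product_topology (\<lambda>k. discrete_topology (E k)) I) T) G"
proof (rule homeomorphic_maps_imp_map[where g = "inv_into S G"])
  have inv: "inv_into S G h = (\<lambda>k\<in>I. inv_into (D k) (F k) (h k))" if "h \<in> T" for h
  proof -
    from that G_bij obtain f where f: "f \<in> S" "h = G f" by (auto simp: bij_betw_def)
    have "inv_into S G h = f" using f G_bij by (simp add: bij_betw_inv_into_left)
    moreover have "f k = inv_into (D k) (F k) (h k)" if "k \<in> I" for k
    proof -
      have "h k = F k (f k)" using f G[OF f(1)] that by simp
      moreover have "f k \<in> D k" using f(1) S that by blast
      ultimately show ?thesis using F[OF that] by (simp add: inv_into_f_f)
    qed
    moreover have "f = restrict f I" using f(1) S by (auto simp: PiE_restrict)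
    ultimately show ?thesis by (metis (mono_tags, lifting) restrict_ext)
  qed
  show "homeomorphic_maps (subtopology (product_topology (\<lambda>k. discrete_topology (D k)) I) S)
      (subtopology (product_topology (\<lambda>k. discrete_topology (E k)) I) T) G (inv_into S G)"
    unfolding homeomorphic_maps_def
  proof (intro conjI ballI)
    show "continuous_map (subtopology (product_topology (\<lambda>k. discrete_topology (D k)) I) S)
        (subtopology (product_topology (\<lambda>k. discrete_topology (E k)) I) T) G"
      using S T G G_bij by (intro continuous_map_coordinatewise) (auto simp: bij_betw_def)
    show "continuous_map (subtopology (product_topology (\<lambda>k. discrete_topology (E k)) I) T)
        (subtopology (product_topology (\<lambda>k. discrete_topology (D k)) I) S) (inv_into S G)"
      using S T inv bij_betw_inv_into[OF G_bij]
      by (intro continuous_map_coordinatewise) (auto simp: bij_betw_def)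
  qed (use S T G_bij in \<open>auto simp: bij_betw_inv_into_left bij_betw_inv_into_right\<close>)
qed

section \<open>The inverse limit\<close>

lemma G_lim_subset_PiE: "carrier (G_lim n A) \<subseteq> (\<Pi>\<^sub>E k\<in>{1..}. carrier (G_level n A k))"
  by (auto simp: G_lim_def)

text \<open>By compatibility, a representative of the \<open>k\<close>-th coordinate represents all the earlier ones too.\<close>

lemma G_lim_representative:
  assumes A: "A \<in> carrier_mat n n" and f: "f \<in> carrier (G_lim n A)" and k: "k \<ge> 1"
  obtains x where "x \<in> carrier_mat 1 n" and "\<And>l. 1 \<le> l \<Longrightarrow> l \<le> k \<Longrightarrow> f l = level_coset n A l x"
proof -
  have "f k \<in> carrier (G_level n A k)" using f k G_lim_subset_PiE by (auto dest!: subsetD)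
  then obtain x where x: "x \<in> carrier_mat 1 n" "f k = level_coset n A k x"
    by (auto simp: carrier_G_level[OF A])
  show thesis
  proof (rule that[OF x(1)])
    fix l assume l: "1 \<le> l" "l \<le> k"
    have "G_proj n A k l (f k) = f l" using f l by (simp add: G_lim_def)
    then show "f l = level_coset n A l x"
      using G_proj_level_coset[OF A l(2) x(1)] x(2) by simp
  qed
qed

lemma G_limI:
  assumes A: "A \<in> carrier_mat n n" and ext: "f \<in> extensional {1..}"
    and x: "\<And>k. k \<ge> 1 \<Longrightarrow> x k \<in> carrier_mat 1 n"
    and f: "\<And>l k. 1 \<le> l \<Longrightarrow> l \<le> k \<Longrightarrow> f l = level_coset n A l (x k)"
  shows "f \<in> carrier (G_lim n A)"
proof -
  have "f k \<in> carrier (G_level n A k)" if "k \<ge> 1" for k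
    using f[OF that order_refl] x[OF that] by (simp add: carrier_G_level[OF A])
  moreover have "G_proj n A k l (f k) = f l" if l: "1 \<le> l" "l \<le> k" for l k
  proof -
    have k: "1 \<le> k" using l by simp
    show ?thesis
      using G_proj_level_coset[OF A l(2) x[OF k]] f[OF k order_refl] f[OF l] by simp
  qed
  ultimately show ?thesis using ext by (simp add: G_lim_def PiE_def Pi_def)
qed

lemma G_lim_simps:
  "f \<oplus>\<^bsub>G_lim n A\<^esub> g = (\<lambda>k\<in>{1..}. f k \<oplus>\<^bsub>G_level n A k\<^esub> g k)"
  "r \<odot>\<^bsub>G_lim n A\<^esub> f = (\<lambda>k\<in>{1..}. r \<odot>\<^bsub>G_level n A k\<^esub> f k)"
  by (simp_all add: G_lim_def)

text \<open>The hypothesis \<open>coh\<close> says that the isomorphisms commute with the projections. Then the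
  coordinatewise map sends compatible families to compatible families, and by injectivity at each
  level the coordinatewise preimage of a compatible family is compatible.\<close>

lemma coherent_level_isomorphisms_induce_limit_isomorphism:
  assumes A: "A \<in> carrier_mat n n" and B: "B \<in> carrier_mat n n"
    and iso: "\<And>k. level_isomorphism n A B k (\<psi> k)"
    and coh: "\<And>k l x. l \<le> k \<Longrightarrow> x \<in> carrier_mat 1 n
      \<Longrightarrow> level_coset n B l (\<psi> k x) = level_coset n B l (\<psi> l x)"
  shows "\<exists>\<Psi>. \<Psi> \<in> module_iso (poly_ring_mod n A) (G_lim n A) (G_lim n B) \<and>
           homeomorphic_map (G_topology n A) (G_topology n B) \<Psi>"
proof -
  let ?V = "carrier_mat 1 n :: int mat set"
  note \<psi>V = level_isomorphismD(1)[OF iso]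
  note inj = level_isomorphismD(4)[OF iso]
  have "\<forall>k. \<exists>F. \<forall>x\<in>?V. F (level_coset n A k x) = level_coset n B k (\<psi> k x)"
  proof (rule allI, rule level_isomorphism_factors[OF A B iso])
    fix k F assume "\<And>x. x \<in> ?V \<Longrightarrow> F (level_coset n A k x) = level_coset n B k (\<psi> k x)"
    then show "\<exists>F. \<forall>x\<in>?V. F (level_coset n A k x) = level_coset n B k (\<psi> k x)"
      by (intro exI ballI)
  qed
  from choice[OF this] obtain F
    where FV: "\<forall>k. \<forall>x\<in>?V. F k (level_coset n A k x) = level_coset n B k (\<psi> k x)" ..
  have F: "F k (level_coset n A k x) = level_coset n B k (\<psi> k x)" if "x \<in> ?V" for k x
    using FV[THEN spec, THEN bspec, OF that] .
  define \<Psi> where "\<Psi> f = (\<lambda>k\<in>{1..}. F k (f k))" for f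
  have F_inj: "inj_on (F k) (carrier (G_level n A k))" for k
  proof (rule inj_onI)
    fix X Y assume "X \<in> carrier (G_level n A k)" "Y \<in> carrier (G_level n A k)" and eq: "F k X = F k Y"
    then obtain x y where "x \<in> ?V" "y \<in> ?V" "X = level_coset n A k x" "Y = level_coset n A k y"
      by (auto simp: carrier_G_level[OF A])
    with eq show "X = Y" by (simp add: F inj)
  qed
  note PiE = G_lim_subset_PiE
  have into: "\<Psi> f \<in> carrier (G_lim n B)" if f: "f \<in> carrier (G_lim n A)" for f
  proof -
    have "\<exists>x. x \<in> ?V \<and> (\<forall>l. 1 \<le> l \<longrightarrow> l \<le> k \<longrightarrow> f l = level_coset n A l x)" if "k \<ge> 1" for k
      by (rule G_lim_representative[OF A f that]) blast
    then obtain x where x: "\<And>k. k \<ge> 1 \<Longrightarrow> x k \<in> ?V"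
      and fx: "\<And>l k. 1 \<le> l \<Longrightarrow> l \<le> k \<Longrightarrow> f l = level_coset n A l (x k)"
      by (metis le_trans)
    show ?thesis
    proof (rule G_limI[OF B])
      show "\<Psi> f \<in> extensional {1..}" by (simp add: \<Psi>_def)
      show "\<psi> k (x k) \<in> ?V" if "k \<ge> 1" for k using \<psi>V[OF x[OF that]] .
      show "\<Psi> f l = level_coset n B l (\<psi> k (x k))" if l: "1 \<le> l" "l \<le> k" for l k
      proof -
        have "x k \<in> ?V" using l by (intro x) simp
        then show ?thesis using fx[OF l] F coh[OF l(2)] l(1) by (simp add: \<Psi>_def)
      qed
    qed
  qed
  have "inj_on \<Psi> (carrier (G_lim n A))"
  proof (rule inj_onI)
    fix f g assume f: "f \<in> carrier (G_lim n A)" and g: "g \<in> carrier (G_lim n A)" and eq: "\<Psi> f = \<Psi> g"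
    have fg: "f k = g k" if "k \<in> {1..}" for k
    proof (rule inj_onD[OF F_inj])
      show "F k (f k) = F k (g k)" using fun_cong[OF eq, of k] that by (simp add: \<Psi>_def)
    qed (use f g PiE that in blast)+
    show "f = g" by (rule PiE_ext[OF subsetD[OF PiE f] subsetD[OF PiE g] fg])
  qed
  moreover have "\<exists>f\<in>carrier (G_lim n A). \<Psi> f = h" if h: "h \<in> carrier (G_lim n B)" for h
  proof -
    have "\<exists>x. x \<in> ?V \<and> (\<forall>l. 1 \<le> l \<longrightarrow> l \<le> k \<longrightarrow> level_coset n B l (\<psi> k x) = h l)" if "k \<ge> 1" for k
    proof -
      obtain w where w: "w \<in> ?V" "\<And>l. 1 \<le> l \<Longrightarrow> l \<le> k \<Longrightarrow> h l = level_coset n B l w"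
        using G_lim_representative[OF B h \<open>k \<ge> 1\<close>] by metis
      obtain x where x: "x \<in> ?V" "level_coset n B k (\<psi> k x) = level_coset n B k w"
        using level_isomorphismD(5)[OF iso w(1)] by blast
      have "level_coset n B l (\<psi> k x) = h l" if "1 \<le> l" "l \<le> k" for l
        using level_coset_coarsen[OF B that(2) \<psi>V[OF x(1)] w(1) x(2)] w(2)[OF that] by simp
      with x(1) show ?thesis by (intro exI conjI allI impI)
    qed
    then obtain x where x: "\<And>k. k \<ge> 1 \<Longrightarrow> x k \<in> ?V"
      and xh: "\<And>k l. 1 \<le> l \<Longrightarrow> l \<le> k \<Longrightarrow> level_coset n B l (\<psi> k (x k)) = h l"
      by (metis le_trans)
    define f where "f = (\<lambda>k\<in>{1..}. level_coset n A k (x k))"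
    \<comment> \<open>Both \<open>x k\<close> and \<open>x l\<close> are sent to \<open>h l\<close> at level \<open>l\<close>, so injectivity identifies their cosets.\<close>
    have fx: "f l = level_coset n A l (x k)" if "1 \<le> l" "l \<le> k" for l k
    proof -
      have xk: "x k \<in> ?V" and xl: "x l \<in> ?V" using that x by auto
      have "level_coset n B l (\<psi> l (x k)) = level_coset n B l (\<psi> l (x l))"
        using coh[OF that(2) xk] xh[OF that] xh[OF that(1) order_refl] by simp
      then show ?thesis using that inj[OF xk xl] by (simp add: f_def)
    qed
    have "f \<in> carrier (G_lim n A)"
      by (rule G_limI[OF A _ x fx]) (simp_all add: f_def extensional_def)
    moreover have "\<Psi> f k = h k" for k
    proof (cases "k \<ge> 1")
      case True
      then show ?thesis using F[OF x[OF True]] xh[OF True order_refl] by (simp add: \<Psi>_def f_def)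
    next
      case False
      have "h \<in> extensional {1..}" using h PiE by (auto simp: PiE_def dest!: subsetD)
      with False show ?thesis by (simp add: \<Psi>_def extensional_def)
    qed
    ultimately show ?thesis by (intro bexI[of _ f] ext)
  qed
  ultimately have bij: "bij_betw \<Psi> (carrier (G_lim n A)) (carrier (G_lim n B))"
    using into unfolding bij_betw_def by blast
  have add: "\<Psi> (f \<oplus>\<^bsub>G_lim n A\<^esub> g) = \<Psi> f \<oplus>\<^bsub>G_lim n B\<^esub> \<Psi> g"
    if f: "f \<in> carrier (G_lim n A)" and g: "g \<in> carrier (G_lim n A)" for f g
    unfolding G_lim_simps \<Psi>_def
  proof (rule restrict_ext)
    fix k :: nat assume k: "k \<in> {1..}"
    then have k1: "1 \<le> k" by simp
    obtain x where x: "x \<in> ?V" "f k = level_coset n A k x"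
      by (rule G_lim_representative[OF A f k1]) (use k1 in blast)
    obtain y where y: "y \<in> ?V" "g k = level_coset n A k y"
      by (rule G_lim_representative[OF A g k1]) (use k1 in blast)
    have "F k (f k \<oplus>\<^bsub>G_level n A k\<^esub> g k) = F k (f k) \<oplus>\<^bsub>G_level n B k\<^esub> F k (g k)"
      using x y \<psi>V level_isomorphismD(2)[OF iso x(1) y(1)]
      by (simp add: add_G_level[OF A] add_G_level[OF B] F)
    with k show "F k ((\<lambda>k\<in>{1..}. f k \<oplus>\<^bsub>G_level n A k\<^esub> g k) k)
        = (\<lambda>k\<in>{1..}. F k (f k)) k \<oplus>\<^bsub>G_level n B k\<^esub> (\<lambda>k\<in>{1..}. F k (g k)) k" by simp
  qed
  have smult: "\<Psi> (r \<odot>\<^bsub>G_lim n A\<^esub> f) = r \<odot>\<^bsub>G_lim n B\<^esub> \<Psi> f"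
    if f: "f \<in> carrier (G_lim n A)" for r f
    unfolding G_lim_simps \<Psi>_def
  proof (rule restrict_ext)
    fix k :: nat assume k: "k \<in> {1..}"
    then have k1: "1 \<le> k" by simp
    obtain x where x: "x \<in> ?V" "f k = level_coset n A k x"
      by (rule G_lim_representative[OF A f k1]) (use k1 in blast)
    have "x * mat_eval n (SOME q. q \<in> r) A \<in> ?V" using x A by auto
    then have "F k (r \<odot>\<^bsub>G_level n A k\<^esub> f k) = r \<odot>\<^bsub>G_level n B k\<^esub> F k (f k)"
      using x \<psi>V level_isomorphismD(3)[OF iso x(1)]
      by (simp add: smult_G_level[OF A] smult_G_level[OF B] F)
    with k show "F k ((\<lambda>k\<in>{1..}. r \<odot>\<^bsub>G_level n A k\<^esub> f k) k)
        = r \<odot>\<^bsub>G_level n B k\<^esub> (\<lambda>k\<in>{1..}. F k (f k)) k" by simp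
  qed
  have "\<Psi> \<in> module_iso (poly_ring_mod n A) (G_lim n A) (G_lim n B)"
    unfolding module_iso_def LinearCombinations.module_hom_def
    using bij into add smult by simp
  moreover have "homeomorphic_map (G_topology n A) (G_topology n B) \<Psi>"
    unfolding G_topology_def
    by (rule homeomorphic_map_coordinatewise[OF PiE PiE bij, of F]) (simp_all only: \<Psi>_def F_inj)
  ultimately show ?thesis by blast
qed

theorem theorem5p1:
  fixes n :: nat and A B :: "int mat"
  assumes "n \<ge> 1"
    and "A \<in> GL n" and "B \<in> GL n"
    and "hyperbolic A" and "hyperbolic B"
    and "similar_over_rat n A B"
    and "strongly_BF_equivalent n A B"
  shows "\<exists>\<Psi>. \<Psi> \<in> module_iso (poly_ring_mod n A) (G_lim n A) (G_lim n B) \<and>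
              homeomorphic_map (G_topology n A) (G_topology n B) \<Psi>"
proof -
  have A: "A \<in> carrier_mat n n" and B: "B \<in> carrier_mat n n"
    using assms(2,3) by (auto simp: GL_def)
  let ?r = "\<lambda>k \<psi>. \<lambda>x\<in>carrier_mat 1 n. level_coset n B k (\<psi> x)"
  \<comment> \<open>The limit starts at level \<open>1\<close>; level \<open>0\<close> may be carried along, because \<open>0! = 1\<close> is positive too.\<close>
  have "\<exists>\<psi>. level_isomorphism n A B k \<psi>" for k
  proof -
    have "det (poly_mat n (level_poly k) A) \<noteq> 0"
      using det_pow_minus_one_nonzero[OF A assms(4), of "fact k"]
      by (simp add: poly_mat_eq_mat_eval[OF A] level_poly_def mat_eval_pow_minus_one[OF A])
    then obtain h where "h \<in> module_iso (poly_ring_mod n A) (G_level n A k) (G_level n B k)"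
      using assms(7) unfolding strongly_BF_equivalent_def G_level_eq_BF[OF A] G_level_eq_BF[OF B] by blast
    with A B annihilator_similar[OF A B assms(6)] show ?thesis by (rule level_isomorphism_exists)
  qed
  then obtain \<psi> where iso: "\<And>k. level_isomorphism n A B k (\<psi> k)"
    and coh: "\<And>l k. l \<le> k \<Longrightarrow> ?r l (\<psi> k) = ?r l (\<psi> l)"
    using koenig_coherent_choice[of "level_isomorphism n A B" ?r]
      level_isomorphism_descend[OF A B] finite_level_isomorphism_classes[OF A B assms(4,5)]
    by blast
  show ?thesis
  proof (rule coherent_level_isomorphisms_induce_limit_isomorphism[OF A B iso])
    fix k l :: nat and x :: "int mat"
    assume "l \<le> k" and x: "x \<in> carrier_mat 1 n"
    from fun_cong[OF coh[OF \<open>l \<le> k\<close>], of x] x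
    show "level_coset n B l (\<psi> k x) = level_coset n B l (\<psi> l x)" by simp
  qed
qed

end
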